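(* Let $\bm{x}(t)$ be the solution of the stochastic differential equation $$d\bm{x}(t) = -\bm{L}\bm{x}(t)\,dt + \alpha\, d\bm{b}(t),\qquad \bm{x}(0)=\bm{c},$$ where $\alpha>0$, $\bm{b}(t)$ is the $n$-dimensional standard Wiener process, $\bm{L}$ is the weighted Laplacian matrix of a connected undirected graph, and the initial state vector $\bm{c}=(c_1,\dots,c_n)^T$ is random with Gaussian distribution $\mathcal{N}(\bm{0},\bm{I})$ and independent of $\bm{b}$. Let $\gamma=\frac1n\sum_{i=1}^n c_i$. Then for every $t>0$ the mean squared error $$\mathsf{MSE}(t) = \mathsf{E}\left[\|\bm{x}(t)-\gamma\bm{1}\|_2^2\right]$$ is given by $$\mathsf{MSE}(t) = \alpha^2 t + \frac{\alpha^2}{2}\sum_{i=2}^n\frac{1-e^{-2\lambda_i t}}{\lambda_i} + \mathrm{tr}\left(\bm{Q}(t)\bm{Q}(t)^T\right),$$ where $$\bm{Q}(t) = \exp(-\bm{L}t)\left(\bm{I}-\frac1n\bm{1}\bm{1}^T\right).$$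
   Context: $G=(V,E)$ is a connected undirected graph with $V=\{1,\dots,n\}$; $\mathcal{N}_i=\{j\in V: (j,i)\in E,\ j\neq i\}$ is the neighborhood of node $i$. Each edge $(i,j)\in E$ carries a positive weight $\mu_{ij}$ with $\mu_{ij}=\mu_{ji}$. The Laplacian matrix $\bm{L}=\{L_{ij}\}\in\mathbb{R}^{n\times n}$ is defined by $L_{ii}=\sum_{j\in\mathcal{N}_i}\mu_{ij}$, $L_{ij}=-\mu_{ij}$ if $i\neq j$ and $(i,j)\in E$, and $L_{ij}=0$ if $i\ne j$ and $(i,j)\notin E$. It is symmetric positive semidefinite with $\bm{L}\bm{1}=\bm{0}$, where $\bm{1}=(1,\dots,1)^T$, and its eigenvalues are $\lambda_1=0<\lambda_2\le\cdots\le\lambda_n$. $\exp$ denotes the matrix exponential, $\bm{I}$ the $n\times n$ identity matrix, and $\mathrm{tr}$ the trace. The components of the $n$-dimensional standard Wiener process $\bm{b}(t)$ are independent one-dimensional standard Wiener processes starting at $0$. *)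

theory Defs
  imports "HOL-Probability.Probability"
begin

definition neighbourhood :: "('n \<times> 'n) set \<Rightarrow> 'n \<Rightarrow> 'n set" where
  "neighbourhood E i = {j. (j, i) \<in> E \<and> j \<noteq> i}"

(* The vertex set is the whole finite type 'n.  Values of mu outside E are irrelevant. *)
definition connected_weighted_graph ::
    "('n::finite \<times> 'n) set \<Rightarrow> ('n \<Rightarrow> 'n \<Rightarrow> real) \<Rightarrow> bool" where
  "connected_weighted_graph E \<mu> \<longleftrightarrow>
     sym E \<and> (\<forall>i j. (i, j) \<in> E\<^sup>*) \<and>
     (\<forall>(i, j) \<in> E. 0 < \<mu> i j \<and> \<mu> i j = \<mu> j i)"

definition laplacian ::
    "('n::finite \<times> 'n) set \<Rightarrow> ('n \<Rightarrow> 'n \<Rightarrow> real) \<Rightarrow> real^'n^'n" where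
  "laplacian E \<mu> = (\<chi> i j.
     if i = j then (\<Sum>k\<in>neighbourhood E i. \<mu> i k)
     else if (i, j) \<in> E then - \<mu> i j
     else 0)"

(* lam 1, ..., lam n are the roots of the characteristic polynomial, with multiplicity,
   in increasing order; values of lam outside {1..n} are irrelevant. *)
definition ordered_eigenvalues :: "real^'n^'n \<Rightarrow> (nat \<Rightarrow> real) \<Rightarrow> bool" where
  "ordered_eigenvalues A lam \<longleftrightarrow>
     mono_on {1..CARD('n)} lam \<and>
     (\<forall>z. det (mat z - A) = (\<Prod>i=1..CARD('n). (z - lam i)))"

(* The type real^'n^'n carries the componentwise product, so neither the power operator nor the
   library's exp is available for the matrix product. *)
primrec matrix_power :: "real^'n^'n \<Rightarrow> nat \<Rightarrow> real^'n^'n" where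
  "matrix_power A 0 = mat 1"
| "matrix_power A (Suc k) = A ** matrix_power A k"

definition matrix_exp :: "real^'n^'n \<Rightarrow> real^'n^'n" where
  "matrix_exp A = (\<Sum>k. matrix_power A k /\<^sub>R fact k)"

(* Density of the normal distribution N(m, S), for S symmetric positive definite. *)
definition gaussian_density :: "real^'n \<Rightarrow> real^'n^'n \<Rightarrow> real^'n \<Rightarrow> real" where
  "gaussian_density m S v =
     exp (- ((v - m) \<bullet> (matrix_inv S *v (v - m))) / 2) / sqrt ((2 * pi) ^ CARD('n) * det S)"

(* Time is [0,\<infinity>): values of a process at negative times are irrelevant.
   The second argument of normal_density is the standard deviation. *)
definition standard_wiener :: "'a measure \<Rightarrow> (real \<Rightarrow> 'a \<Rightarrow> real) \<Rightarrow> bool" where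
  "standard_wiener M W \<longleftrightarrow>
     (\<forall>t\<ge>0. W t \<in> borel_measurable M) \<and>
     (AE \<omega> in M. W 0 \<omega> = 0) \<and>
     (AE \<omega> in M. continuous_on {0..} (\<lambda>t. W t \<omega>)) \<and>
     (\<forall>s t. 0 \<le> s \<longrightarrow> s < t \<longrightarrow>
        distributed M lborel (\<lambda>\<omega>. W t \<omega> - W s \<omega>) (normal_density 0 (sqrt (t - s)))) \<and>
     (\<forall>(\<tau> :: nat \<Rightarrow> real) m. 0 \<le> \<tau> 0 \<longrightarrow> (\<forall>i<m. \<tau> i < \<tau> (Suc i)) \<longrightarrow>
        prob_space.indep_vars M (\<lambda>_. borel) (\<lambda>i \<omega>. W (\<tau> (Suc i)) \<omega> - W (\<tau> i) \<omega>) {..<m})"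

definition path_map :: "(real \<Rightarrow> 'a \<Rightarrow> 'b) \<Rightarrow> 'a \<Rightarrow> (real \<Rightarrow> 'b)" where
  "path_map X \<omega> = (\<lambda>t\<in>{0..}. X t \<omega>)"

abbreviation path_algebra :: "(real \<Rightarrow> 'b::topological_space) measure" where
  "path_algebra \<equiv> PiM {0..} (\<lambda>_. borel)"

(* The components are independent as processes, not merely at each fixed time. *)
definition standard_wiener_vec :: "'a measure \<Rightarrow> (real \<Rightarrow> 'a \<Rightarrow> real^'n) \<Rightarrow> bool" where
  "standard_wiener_vec M b \<longleftrightarrow>
     (\<forall>i. standard_wiener M (\<lambda>t \<omega>. b t \<omega> $ i)) \<and>
     prob_space.indep_vars M (\<lambda>_. path_algebra) (\<lambda>i. path_map (\<lambda>t \<omega>. b t \<omega> $ i)) UNIV"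

(* Independence of a random vector and a whole process; prob_space.indep_var does not apply
   because it requires both variables to have the same value type. *)
definition indep_of_process ::
    "'a measure \<Rightarrow> ('a \<Rightarrow> real^'n) \<Rightarrow> (real \<Rightarrow> 'a \<Rightarrow> real^'n) \<Rightarrow> bool" where
  "indep_of_process M c b \<longleftrightarrow>
     prob_space.indep_set M
       (sets (vimage_algebra (space M) c borel))
       (sets (vimage_algebra (space M) (path_map b) path_algebra))"

(* X solves dX = A X dt + \<alpha> db, X(0) = c, i.e. X(t) = c + int_0^t A X(s) ds + int_0^t \<alpha> db(s).
   The integrand of the stochastic integral is constant, so that integral is
   \<alpha> (b(t) - b(0)) by definition.  Adaptedness need not be required: a process satisfying
   the conditions below is almost surely determined by c and b up to time t. *)
definition linear_sde_solution ::
    "'a measure \<Rightarrow> real^'n^'n \<Rightarrow> real \<Rightarrow> (real \<Rightarrow> 'a \<Rightarrow> real^'n) \<Rightarrow> ('a \<Rightarrow> real^'n)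
      \<Rightarrow> (real \<Rightarrow> 'a \<Rightarrow> real^'n) \<Rightarrow> bool" where
  "linear_sde_solution M A \<alpha> b c X \<longleftrightarrow>
     (\<forall>t\<ge>0. X t \<in> borel_measurable M) \<and>
     (AE \<omega> in M. continuous_on {0..} (\<lambda>t. X t \<omega>)) \<and>
     (AE \<omega> in M. \<forall>t\<ge>0.
        X t \<omega> = c \<omega> + integral {0..t} (\<lambda>s. A *v X s \<omega>) + \<alpha> *\<^sub>R (b t \<omega> - b 0 \<omega>))"

end

theory Submission
  imports Defs
begin

text \<open>
  The Laplacian \<open>L\<close> is symmetric, so it has an orthonormal eigenbasis
  (\<open>symmetric_matrix_diagonalisable\<close>). In this basis the equation falls apart into \<open>n\<close> scalar equations
  \<open>dy = - d\<^sub>k y dt + \<alpha> dw\<close>. Since the covariances of the noise and of the initial state are multiples of the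
  identity, they keep their form in the new basis: each \<open>w\<close> has covariance function \<open>min s u\<close>, each initial
  value has second moment \<open>1\<close>, and the two are uncorrelated. The squared norm of the error is the sum of the
  squares of its coordinates, so the mean squared error is a sum of scalar contributions.

  Because the graph is connected and the weights are positive, the eigenvalue \<open>0\<close> is simple and its
  eigenvector is proportional to \<open>vec 1\<close> (\<open>laplacian_diagonalisable\<close>). Hence \<open>\<gamma> *\<^sub>R vec 1\<close> is the part of
  the initial state in the average mode \<open>k0\<close>, and subtracting it removes the initial value from this mode and
  leaves the others untouched. By \<open>linear_sde_mean_square\<close>, mode \<open>k\<close> contributes
  \<open>(exp (- d\<^sub>k t) - q\<^sub>k)\<^sup>2\<close> from the initial state, where \<open>q\<^sub>k\<close> is \<open>1\<close> for \<open>k = k0\<close> and \<open>0\<close> otherwise, and \<open>\<alpha>\<^sup>2\<close> times the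
  Ornstein-Uhlenbeck variance from the noise. The first terms add up to the trace, because \<open>Q t\<close> is diagonal
  in the same basis. The variances are \<open>t\<close> for \<open>k0\<close> and \<open>(1 - exp (- 2 d\<^sub>k t)) / (2 d\<^sub>k)\<close> otherwise, and they
  give the remaining two terms once the \<open>d\<^sub>k\<close> are matched with the ordered eigenvalues
  (\<open>sum_nonminimal_eigenvalues\<close>).

  The noise is additive, so no stochastic integration is needed: almost every path satisfies a deterministic
  integral equation, which variation of constants solves by a formula that contains the noise only through
  its values and a time integral (\<open>linear_integral_equation_solution\<close>). The second moments of this
  formula follow by exchanging expectation and time integral (\<open>time_integral_moments\<close>,
  \<open>ornstein_uhlenbeck_moments\<close>).
\<close>

section \<open>Orthogonal diagonalisation of symmetric matrices\<close>

text \<open>A maximiser \<open>v\<close> of the Rayleigh quotient on the unit sphere of \<open>S\<close> is an eigenvector: the residual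
\<open>w = f v - l v\<close> lies in \<open>S\<close> and is orthogonal to \<open>v\<close>, so moving from \<open>v\<close> in the direction \<open>w\<close> would
increase the quotient to first order unless \<open>w = 0\<close>.\<close>

lemma self_adjoint_eigenvector_in_invariant_subspace:
  fixes f :: "'v::euclidean_space \<Rightarrow> 'v"
  assumes "linear f" and self_adjoint: "\<And>x y. f x \<bullet> y = x \<bullet> f y"
    and S: "subspace S" and inv: "f ` S \<subseteq> S" and ne: "S \<noteq> {0}"
  obtains v l where "v \<in> S" "norm v = 1" "f v = l *\<^sub>R v"
proof -
  interpret f: linear f by fact
  let ?K = "S \<inter> sphere 0 1"
  have "0 \<in> S" using S by (rule subspace_0)
  then obtain z where z: "z \<in> S" "z \<noteq> 0" using ne by blast
  then have "(1 / norm z) *\<^sub>R z \<in> ?K"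
    using S by (auto simp: subspace_scale)
  then have "?K \<noteq> {}" by blast
  moreover have "compact ?K"
    by (intro closed_Int_compact closed_subspace S compact_sphere)
  moreover have "continuous_on ?K (\<lambda>x. f x \<bullet> x)"
    by (intro continuous_intros linear_continuous_on) (use \<open>linear f\<close> in \<open>simp add: linear_linear\<close>)
  ultimately obtain v where v: "v \<in> ?K" and max: "\<And>y. y \<in> ?K \<Longrightarrow> f y \<bullet> y \<le> f v \<bullet> v"
    using continuous_attains_sup[of ?K "\<lambda>x. f x \<bullet> x"] by blast
  define l where "l = f v \<bullet> v"
  have v1: "v \<in> S" "v \<bullet> v = 1" using v by (auto simp: norm_eq_1)
  have bound: "f y \<bullet> y \<le> l * (y \<bullet> y)" if "y \<in> S" for y
  proof (cases "y = 0")
    case False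
    then have "(1 / norm y) *\<^sub>R y \<in> ?K"
      using S that by (auto simp: subspace_scale)
    from max[OF this] have "(1 / norm y)\<^sup>2 * (f y \<bullet> y) \<le> l"
      by (simp add: f.scaleR l_def power2_eq_square)
    then show ?thesis
      using False by (simp add: field_simps dot_square_norm)
  qed (simp add: f.zero)
  define w where "w = f v - l *\<^sub>R v"
  have wS: "w \<in> S"
    unfolding w_def using v1 S inv by (intro subspace_diff subspace_scale) auto
  have wv: "v \<bullet> w = 0"
    using v1 by (simp add: w_def l_def inner_diff_right inner_commute)
  have fvw: "f v \<bullet> w = w \<bullet> w"
    using wv by (simp add: w_def inner_diff_left)
  \<comment> \<open>Maximality at \<open>v\<close>, tested at \<open>v + r w\<close>: the term linear in \<open>r\<close> is \<open>2 r (w \<bullet> w)\<close>.\<close>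
  have var: "2 * r * (w \<bullet> w) \<le> r\<^sup>2 * (l * (w \<bullet> w) - f w \<bullet> w)" for r
  proof -
    have "v + r *\<^sub>R w \<in> S" using v1 wS S by (intro subspace_add subspace_scale) auto
    from bound[OF this]
    have "f v \<bullet> v + r * (f v \<bullet> w) + r * (f w \<bullet> v) + r\<^sup>2 * (f w \<bullet> w) \<le> l * (1 + r\<^sup>2 * (w \<bullet> w))"
      using v1 wv by (simp add: f.add f.scaleR inner_add_left inner_add_right power2_eq_square
          inner_commute algebra_simps)
    moreover have "f w \<bullet> v = w \<bullet> w" using fvw self_adjoint[of w v] by (simp add: inner_commute)
    ultimately show ?thesis using fvw by (simp add: l_def algebra_simps)
  qed
  have "w \<bullet> w = 0"
  proof (rule ccontr)
    assume "w \<bullet> w \<noteq> 0"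
    then have pos: "w \<bullet> w > 0" by simp
    \<comment> \<open>A small positive step \<open>r\<close> makes the linear term beat the quadratic one.\<close>
    define C where "C = \<bar>l * (w \<bullet> w) - f w \<bullet> w\<bar> + 1"
    have C: "C > 0" "l * (w \<bullet> w) - f w \<bullet> w \<le> C" by (auto simp: C_def)
    define r where "r = (w \<bullet> w) / C"
    have r: "r > 0" using pos C by (simp add: r_def)
    have "2 * r * (w \<bullet> w) \<le> r\<^sup>2 * C"
      using var[of r] C(2) mult_left_mono[OF C(2), of "r\<^sup>2"] by simp
    also have "\<dots> = r * (w \<bullet> w)" using C by (simp add: r_def power2_eq_square)
    finally show False using r pos by simp
  qed
  then have "f v = l *\<^sub>R v" by (simp add: w_def)
  moreover have "norm v = 1" using v by simp
  ultimately show ?thesis using v1 that by blast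
qed

text \<open>An orthonormal set of eigenvectors of maximal size spans the space: otherwise its orthogonal complement is
a nonzero invariant subspace and contributes one more eigenvector. Choosing a set of maximal size replaces
an induction on the dimension.\<close>

lemma self_adjoint_orthonormal_eigenbasis:
  fixes f :: "'v::euclidean_space \<Rightarrow> 'v"
  assumes "linear f" and self_adjoint: "\<And>x y. f x \<bullet> y = x \<bullet> f y"
  obtains B where "pairwise orthogonal B" "\<And>v. v \<in> B \<Longrightarrow> norm v = 1" "finite B" "card B = DIM('v)"
    "\<And>v. v \<in> B \<Longrightarrow> \<exists>l. f v = l *\<^sub>R v"
proof -
  interpret f: linear f by fact
  define P where "P B \<longleftrightarrow> pairwise orthogonal B \<and> (\<forall>v\<in>B. norm v = 1 \<and> (\<exists>l. f v = l *\<^sub>R v))" for B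
  have indep: "independent B \<and> finite B \<and> card B \<le> DIM('v)" if "P B" for B
    using that[unfolded P_def] pairwise_orthogonal_independent[of B] independent_bound[of B] by force
  have "\<exists>B. P B \<and> (\<forall>B'. P B' \<longrightarrow> card B' \<le> card B)"
  proof -
    have "P {}" by (simp add: P_def)
    moreover have "\<forall>B. P B \<longrightarrow> card B < Suc DIM('v)"
      by (metis indep less_Suc_eq_le)
    ultimately show ?thesis by (rule ex_has_greatest_nat)
  qed
  then obtain B where PB: "P B" and max: "\<And>B'. P B' \<Longrightarrow> card B' \<le> card B" by blast
  have B: "pairwise orthogonal B" "\<And>v. v \<in> B \<Longrightarrow> norm v = 1" "\<And>v. v \<in> B \<Longrightarrow> \<exists>l. f v = l *\<^sub>R v"
    using PB by (auto simp: P_def)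
  define S where "S = {x. \<forall>v\<in>B. v \<bullet> x = 0}"
  have S: "subspace S" by (auto simp: subspace_def S_def inner_add_right)
  have inv: "f ` S \<subseteq> S"
  proof safe
    fix x assume x: "x \<in> S"
    have "v \<bullet> f x = 0" if v: "v \<in> B" for v
    proof -
      obtain l where "f v = l *\<^sub>R v" using B(3) v by blast
      then show ?thesis using x v self_adjoint[of v x] by (simp add: S_def)
    qed
    then show "f x \<in> S" by (simp add: S_def)
  qed
  have S0: "S = {0}"
  proof (rule ccontr)
    assume "S \<noteq> {0}"
    from self_adjoint_eigenvector_in_invariant_subspace[OF assms S inv this]
    obtain v l where v: "v \<in> S" "norm v = 1" "f v = l *\<^sub>R v" by metis
    have "v \<notin> B" using v by (force simp: S_def norm_eq_1)
    have "P (insert v B)"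
      using B v by (auto simp: P_def pairwise_insert orthogonal_def S_def inner_commute)
    from max[OF this] show False using \<open>v \<notin> B\<close> indep[OF PB] by simp
  qed
  have "dim B = DIM('v)"
  proof (rule ccontr)
    assume "dim B \<noteq> DIM('v)"
    then have "dim (span B) < DIM('v)" using dim_subset_UNIV[of B] by simp
    then obtain x where "x \<noteq> 0" "\<And>y. y \<in> span B \<Longrightarrow> orthogonal x y"
      using orthogonal_to_subspace_exists[of B] by (metis dim_span)
    then have "x \<in> S" by (auto simp: S_def orthogonal_def inner_commute span_base)
    with \<open>x \<noteq> 0\<close> S0 show False by simp
  qed
  then have "card B = DIM('v)" using indep[OF PB] dim_eq_card_independent by metis
  then show ?thesis using that[of B] B indep[OF PB] by blast
qed

text \<open>The Laplacian, its exponential and the averaging matrix are all handled in the form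
\<open>U ** diagonal_matrix d ** transpose U\<close> with one common orthogonal \<open>U\<close>.\<close>

definition diagonal_matrix :: "('n \<Rightarrow> real) \<Rightarrow> real^'n^'n" where
  "diagonal_matrix d = (\<chi> i j. if i = j then d i else 0)"

theorem symmetric_matrix_diagonalisable:
  fixes A :: "real^'n^'n"
  assumes "transpose A = A"
  obtains U d where "orthogonal_matrix U" "A = U ** diagonal_matrix d ** transpose U"
proof -
  have "linear ((*v) A)" by simp
  moreover have "(A *v x) \<bullet> y = x \<bullet> (A *v y)" for x y
    using dot_lmul_matrix[of x A y] assms by (metis transpose_matrix_vector)
  ultimately obtain B where B: "pairwise orthogonal B" "\<And>v. v \<in> B \<Longrightarrow> norm v = 1" "finite B"
    "card B = DIM(real^'n)" "\<And>v. v \<in> B \<Longrightarrow> \<exists>l. A *v v = l *\<^sub>R v"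
    using self_adjoint_orthonormal_eigenbasis[of "(*v) A"] by blast
  have "card (UNIV :: 'n set) = card B" using B(4) by simp
  then obtain v where v: "bij_betw v (UNIV :: 'n set) B"
    using finite_same_card_bij[OF finite_class.finite_UNIV B(3)] by blast
  have "\<exists>l. A *v v k = l *\<^sub>R v k" for k using v B(5) by (auto simp: bij_betw_def)
  then obtain d where d: "\<And>k. A *v v k = d k *\<^sub>R v k" by metis
  define U where "U = (\<chi> i k. v k $ i)"
  have col: "column k U = v k" for k by (simp add: column_def U_def vec_eq_iff)
  have inj: "v i = v j \<longleftrightarrow> i = j" for i j using v by (auto simp: bij_betw_def inj_def)
  have vB: "v i \<in> B" for i using v by (auto simp: bij_betw_def)
  have U: "orthogonal_matrix U"
    unfolding orthogonal_matrix_orthonormal_columns col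
    using B(1,2) vB inj by (auto simp: pairwise_def)
  have "(A ** U) $ i $ k = (U ** diagonal_matrix d) $ i $ k" for i k
  proof -
    have "(A ** U) $ i $ k = (A *v v k) $ i"
      by (simp add: matrix_matrix_mult_def matrix_vector_mult_def U_def)
    also have "\<dots> = (U ** diagonal_matrix d) $ i $ k"
      by (simp add: d matrix_matrix_mult_def diagonal_matrix_def U_def if_distrib cong: if_cong)
    finally show ?thesis .
  qed
  then have "A ** U = U ** diagonal_matrix d" by (simp add: vec_eq_iff)
  then have "A ** (U ** transpose U) = U ** diagonal_matrix d ** transpose U"
    by (simp add: matrix_mul_assoc)
  then have "A = U ** diagonal_matrix d ** transpose U"
    using U by (simp add: orthogonal_matrix_def)
  with U show ?thesis by (rule that)
qed

section \<open>Matrices diagonalised by a common orthogonal matrix\<close>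

lemma diagonal_matrix_mult:
  "diagonal_matrix d ** diagonal_matrix e = diagonal_matrix (\<lambda>k. d k * e k)"
proof -
  have "(\<Sum>k\<in>UNIV. (if i = k then d i else 0) * (if k = j then e k else 0)) =
    (\<Sum>k\<in>UNIV. if k = i then (if i = j then d i * e i else 0) else 0)" for i j
    by (rule sum.cong) auto
  then show ?thesis
    by (simp add: diagonal_matrix_def matrix_matrix_mult_def vec_eq_iff)
qed

lemma diagonal_matrix_1: "diagonal_matrix (\<lambda>k. 1) = mat 1"
  by (simp add: diagonal_matrix_def mat_def)

lemma orthogonal_conjugate_component:
  "(U ** diagonal_matrix d ** transpose U) $ i $ j = (\<Sum>k\<in>UNIV. U $ i $ k * d k * U $ j $ k)"
  by (simp add: diagonal_matrix_def matrix_matrix_mult_def transpose_def if_distrib cong: if_cong)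

lemma orthogonal_conjugate_diff:
  "U ** diagonal_matrix d ** transpose U - U ** diagonal_matrix e ** transpose U =
    U ** diagonal_matrix (\<lambda>k. d k - e k) ** transpose U" for U :: "real^'n^'n"
  by (simp add: vec_eq_iff orthogonal_conjugate_component left_diff_distrib right_diff_distrib sum_subtractf)

lemma orthogonal_conjugate_mult:
  fixes U :: "real^'n^'n"
  assumes "orthogonal_matrix U"
  shows "(U ** diagonal_matrix d ** transpose U) ** (U ** diagonal_matrix e ** transpose U) =
    U ** diagonal_matrix (\<lambda>k. d k * e k) ** transpose U"
proof -
  have "(U ** diagonal_matrix d ** transpose U) ** (U ** diagonal_matrix e ** transpose U) =
    U ** diagonal_matrix d ** (transpose U ** U) ** diagonal_matrix e ** transpose U"
    by (simp add: matrix_mul_assoc)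
  also have "\<dots> = U ** (diagonal_matrix d ** diagonal_matrix e) ** transpose U"
    using assms by (simp add: orthogonal_matrix matrix_mul_assoc)
  finally show ?thesis by (simp add: diagonal_matrix_mult)
qed

lemma matrix_power_diagonalised:
  fixes U :: "real^'n^'n"
  assumes "orthogonal_matrix U"
  shows "matrix_power (U ** diagonal_matrix d ** transpose U) m =
    U ** diagonal_matrix (\<lambda>k. d k ^ m) ** transpose U"
proof (induction m)
  case 0
  show ?case using assms by (simp add: diagonal_matrix_1 orthogonal_matrix_def)
next
  case (Suc m)
  then show ?case by (simp add: orthogonal_conjugate_mult[OF assms])
qed

text \<open>The exponential series is summed entry by entry; every entry of the \<open>m\<close>-th term is a fixed linear
combination of the numbers \<open>d k ^ m / fact m\<close>. Its convergence is thus obtained without a norm that is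
submultiplicative for the matrix product.\<close>

lemma matrix_exp_diagonalised:
  fixes U :: "real^'n^'n"
  assumes "orthogonal_matrix U"
  shows "matrix_exp (U ** diagonal_matrix d ** transpose U) =
    U ** diagonal_matrix (\<lambda>k. exp (d k)) ** transpose U"
proof -
  let ?S = "\<lambda>m. matrix_power (U ** diagonal_matrix d ** transpose U) m /\<^sub>R fact m"
  let ?T = "U ** diagonal_matrix (\<lambda>k. exp (d k)) ** transpose U"
  have "(\<lambda>m. ?S m $ i $ j) sums (?T $ i $ j)" for i j
  proof -
    have "(\<lambda>m. \<Sum>k\<in>UNIV. U $ i $ k * (d k ^ m /\<^sub>R fact m) * U $ j $ k) sums
       (\<Sum>k\<in>UNIV. U $ i $ k * exp (d k) * U $ j $ k)"
      by (intro sums_sum sums_mult sums_mult2 exp_converges)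
    then show ?thesis
      by (simp add: matrix_power_diagonalised[OF assms] orthogonal_conjugate_component
          sum_distrib_left field_simps)
  qed
  then have "?S sums ?T"
    unfolding sums_def by (intro vec_tendstoI) simp
  then show ?thesis unfolding matrix_exp_def by (rule sums_unique[symmetric])
qed

lemma det_mat_minus_diagonalised:
  fixes U :: "real^'n^'n"
  assumes "orthogonal_matrix U"
  shows "det (mat z - U ** diagonal_matrix d ** transpose U) = (\<Prod>k\<in>UNIV. z - d k)"
proof -
  have "mat z = U ** diagonal_matrix (\<lambda>k. z) ** transpose U"
  proof -
    have "U ** diagonal_matrix (\<lambda>k. z) ** transpose U = z *\<^sub>R (U ** diagonal_matrix (\<lambda>k. 1) ** transpose U)"
      by (simp add: vec_eq_iff orthogonal_conjugate_component sum_distrib_left mult_ac)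
    also have "\<dots> = z *\<^sub>R mat 1"
      using assms by (simp add: diagonal_matrix_1 orthogonal_matrix_def)
    finally show ?thesis by (simp add: mat_def vec_eq_iff)
  qed
  then have "mat z - U ** diagonal_matrix d ** transpose U =
    U ** diagonal_matrix (\<lambda>k. z - d k) ** transpose U"
    by (simp only: orthogonal_conjugate_diff)
  moreover have "det U * det (transpose U) = 1"
    using assms det_mul[of U "transpose U"] by (simp add: orthogonal_matrix_def)
  moreover have "det (diagonal_matrix (\<lambda>k. z - d k)) = (\<Prod>k\<in>UNIV. z - d k)"
    by (subst det_diagonal) (auto simp: diagonal_matrix_def)
  ultimately show ?thesis by (simp add: det_mul mult_ac)
qed

lemma roots_determined_by_product:
  fixes a :: "'i \<Rightarrow> real" and e :: "'j \<Rightarrow> real"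
  assumes "finite I" "finite J" "\<And>z. (\<Prod>i\<in>I. z - a i) = (\<Prod>j\<in>J. z - e j)"
  shows "image_mset a (mset_set I) = image_mset e (mset_set J)"
proof -
  have *: "proots (\<Prod>i\<in>I. [:- a i, 1:]) = image_mset a (mset_set I)"
    if "finite I" for I and a :: "'k \<Rightarrow> real"
    using that by (subst proots_prod) (auto simp: sum_unfold_sum_mset)
  have "poly (\<Prod>i\<in>I. [:- a i, 1:]) = poly (\<Prod>j\<in>J. [:- e j, 1:])"
    using assms(3) by (auto simp: poly_prod)
  then show ?thesis using *[OF assms(1), of a] *[OF assms(2), of e] by (simp add: poly_eq_poly_eq_iff)
qed

text \<open>Translates a sum over the ordered eigenvalues into one over the diagonal of an eigendecomposition. The two
families agree as multisets since they are the roots of the same polynomial, and the smallest ordered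
eigenvalue is the smallest diagonal entry; removing these two equal terms leaves the claim.\<close>

lemma sum_nonminimal_eigenvalues:
  fixes U :: "real^'n^'n" and f :: "real \<Rightarrow> real"
  assumes U: "orthogonal_matrix U"
    and lam: "ordered_eigenvalues (U ** diagonal_matrix d ** transpose U) lam"
    and d0: "\<And>k. d k0 \<le> d k"
  shows "(\<Sum>i=2..CARD('n). f (lam i)) = (\<Sum>k\<in>UNIV - {k0}. f (d k))"
proof -
  have prod: "(\<Prod>i=1..CARD('n). z - lam i) = (\<Prod>k\<in>UNIV. z - d k)" for z
    using lam det_mat_minus_diagonalised[OF U] by (simp add: ordered_eigenvalues_def)
  have mset: "image_mset lam (mset_set {1..CARD('n)}) = image_mset d (mset_set UNIV)"
    by (intro roots_determined_by_product prod) auto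
  have sets: "lam ` {1..CARD('n)} = range d"
    using arg_cong[OF mset, of set_mset] by simp
  have n: "1 \<le> CARD('n)" by (simp add: Suc_le_eq)
  have "lam 1 = d k0"
  proof (rule antisym)
    obtain i where i: "i \<in> {1..CARD('n)}" "lam i = d k0" using sets by (metis imageE rangeI)
    then show "lam 1 \<le> d k0"
      using lam n unfolding ordered_eigenvalues_def mono_on_def by (metis atLeastAtMost_iff order_refl)
    have "lam 1 \<in> range d" using n sets by (metis atLeastAtMost_iff image_eqI order_refl)
    then show "d k0 \<le> lam 1" using d0 by auto
  qed
  have "f (lam 1) + (\<Sum>i=2..CARD('n). f (lam i)) = (\<Sum>i=1..CARD('n). f (lam i))"
    using n by (simp add: sum.atLeast_Suc_atMost numeral_2_eq_2)
  also have "\<dots> = (\<Sum>k\<in>UNIV. f (d k))"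
    using arg_cong[OF mset, of "\<lambda>M. sum_mset (image_mset f M)"]
    by (simp add: sum_unfold_sum_mset image_mset.compositionality comp_def)
  also have "\<dots> = f (d k0) + (\<Sum>k\<in>UNIV - {k0}. f (d k))"
    by (simp add: sum.remove[of UNIV k0])
  finally show ?thesis using \<open>lam 1 = d k0\<close> by simp
qed

lemma trace_diagonalised_square:
  fixes U :: "real^'n^'n"
  assumes "orthogonal_matrix U" "A = U ** diagonal_matrix d ** transpose U"
  shows "trace (A ** transpose A) = (\<Sum>k\<in>UNIV. (d k)\<^sup>2)"
proof -
  have "transpose A = A"
    unfolding assms(2) by (simp add: vec_eq_iff transpose_def[of "U ** _ ** _"] orthogonal_conjugate_component mult_ac)
  then have "trace (A ** transpose A) = trace (U ** (diagonal_matrix (\<lambda>k. d k * d k) ** transpose U))"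
    using orthogonal_conjugate_mult[OF assms(1), of d d] by (simp add: assms(2) matrix_mul_assoc)
  also have "\<dots> = trace (diagonal_matrix (\<lambda>k. d k * d k) ** (transpose U ** U))"
    by (subst trace_mul_sym) (simp add: matrix_mul_assoc)
  also have "\<dots> = (\<Sum>k\<in>UNIV. (d k)\<^sup>2)"
    using assms(1) by (simp add: orthogonal_matrix trace_def diagonal_matrix_def power2_eq_square)
  finally show ?thesis .
qed

text \<open>Taking the inner product with an eigenvector turns the matrix equation into a scalar one; this is the step
that decouples the stochastic differential equation.\<close>

lemma column_inner_diagonalised:
  fixes U :: "real^'n^'n"
  assumes "orthogonal_matrix U"
  shows "column k U \<bullet> ((U ** diagonal_matrix d ** transpose U) *v z) = d k * (column k U \<bullet> z)"
proof -
  have col: "column k U \<bullet> w = (transpose U *v w) $ k" for w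
    by (simp add: matrix_vector_mult_def column_def inner_vec_def transpose_def)
  have "transpose U *v ((U ** diagonal_matrix d ** transpose U) *v z) =
    (transpose U ** U) *v (diagonal_matrix d *v (transpose U *v z))"
    by (simp add: matrix_vector_mul_assoc matrix_mul_assoc del: transpose_matrix_vector)
  also have "\<dots> = diagonal_matrix d *v (transpose U *v z)"
    using assms by (simp add: orthogonal_matrix)
  also have "\<dots> $ k = d k * (transpose U *v z) $ k"
  proof -
    have "(\<Sum>j\<in>UNIV. (if k = j then d k else 0) * y $ j) = (\<Sum>j\<in>UNIV. if j = k then d k * y $ k else 0)"
      for y :: "real^'n"
      by (rule sum.cong) auto
    then have "(diagonal_matrix d *v y) $ k = d k * y $ k" for y
      by (simp add: matrix_vector_mult_def diagonal_matrix_def)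
    then show ?thesis .
  qed
  finally show ?thesis by (simp add: col)
qed

lemma norm_orthonormal_columns:
  fixes U :: "real^'n^'n"
  assumes "orthogonal_matrix U"
  shows "(norm z)\<^sup>2 = (\<Sum>k\<in>UNIV. (column k U \<bullet> z)\<^sup>2)"
proof -
  have "orthogonal_transformation ((*v) (transpose U))"
    using assms by (simp add: orthogonal_transformation_matrix)
  then have "norm z = norm (transpose U *v z)" by (simp add: orthogonal_transformation_norm del: transpose_matrix_vector)
  then have "(norm z)\<^sup>2 = (\<Sum>k\<in>UNIV. ((transpose U *v z) $ k)\<^sup>2)"
    by (simp add: norm_vec_def L2_set_def sum_nonneg)
  then show ?thesis
    by (simp add: matrix_vector_mult_def column_def inner_vec_def transpose_def)
qed

section \<open>Spectrum of the Laplacian\<close>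

lemma laplacian_mult_component:
  assumes "connected_weighted_graph E \<mu>"
  shows "(laplacian E \<mu> *v x) $ i = (\<Sum>j\<in>neighbourhood E i. \<mu> i j * (x $ i - x $ j))"
proof -
  have E: "(i, j) \<in> E \<longleftrightarrow> (j, i) \<in> E" for i j
    using assms by (auto simp: connected_weighted_graph_def sym_def)
  let ?N = "neighbourhood E i"
  have iN: "i \<notin> ?N" by (simp add: neighbourhood_def)
  have "(laplacian E \<mu> *v x) $ i = (\<Sum>j\<in>UNIV. laplacian E \<mu> $ i $ j * x $ j)"
    by (simp add: matrix_vector_mult_def)
  also have "\<dots> = (\<Sum>j\<in>insert i ?N. laplacian E \<mu> $ i $ j * x $ j)"
    by (rule sum.mono_neutral_right) (auto simp: laplacian_def neighbourhood_def E)
  also have "\<dots> = (\<Sum>k\<in>?N. \<mu> i k) * x $ i + (\<Sum>j\<in>?N. - \<mu> i j * x $ j)"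
    using iN by (simp add: laplacian_def) (rule sum.cong, auto simp: neighbourhood_def E)
  finally show ?thesis
    by (simp add: sum_distrib_right sum.distrib[symmetric] sum_subtractf[symmetric] right_diff_distrib)
qed

text \<open>The Dirichlet form. Symmetrising the double sum that comes from \<open>laplacian_mult_component\<close> produces the
squares; the factor one half appears because every edge is counted in both orientations.\<close>

lemma laplacian_quadratic_form:
  assumes "connected_weighted_graph E \<mu>"
  shows "x \<bullet> (laplacian E \<mu> *v x) =
    (\<Sum>i\<in>UNIV. \<Sum>j\<in>neighbourhood E i. \<mu> i j * (x $ i - x $ j)\<^sup>2) / 2"
proof -
  define w where "w i j = (if j \<in> neighbourhood E i then \<mu> i j else 0)" for i j
  have wsym: "w i j = w j i" for i j
    using assms by (auto simp: w_def connected_weighted_graph_def neighbourhood_def sym_def)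
  have w: "(\<Sum>j\<in>neighbourhood E i. \<mu> i j * g j) = (\<Sum>j\<in>UNIV. w i j * g j)" for i g
    by (rule sum.mono_neutral_cong_left) (auto simp: w_def)
  have form: "x \<bullet> (laplacian E \<mu> *v x) = (\<Sum>i\<in>UNIV. \<Sum>j\<in>UNIV. w i j * (x $ i - x $ j) * x $ i)"
    by (simp add: inner_vec_def laplacian_mult_component[OF assms] w sum_distrib_left mult_ac)
  also have "\<dots> = (\<Sum>i\<in>UNIV. \<Sum>j\<in>UNIV. w j i * (x $ j - x $ i) * x $ j)"
    by (rule sum.swap)
  finally have form': "x \<bullet> (laplacian E \<mu> *v x) = (\<Sum>i\<in>UNIV. \<Sum>j\<in>UNIV. w i j * (x $ j - x $ i) * x $ j)"
    by (simp add: wsym)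
  have "2 * (x \<bullet> (laplacian E \<mu> *v x)) =
    (\<Sum>i\<in>UNIV. \<Sum>j\<in>UNIV. w i j * (x $ i - x $ j) * x $ i + w i j * (x $ j - x $ i) * x $ j)"
    using form form' by (simp add: sum.distrib)
  also have "\<dots> = (\<Sum>i\<in>UNIV. \<Sum>j\<in>UNIV. w i j * (x $ i - x $ j)\<^sup>2)"
    by (simp add: power2_eq_square algebra_simps)
  finally have "2 * (x \<bullet> (laplacian E \<mu> *v x)) = (\<Sum>i\<in>UNIV. \<Sum>j\<in>UNIV. w i j * (x $ i - x $ j)\<^sup>2)" .
  then show ?thesis by (simp add: w)
qed

lemma laplacian_psd:
  assumes "connected_weighted_graph E \<mu>"
  shows "0 \<le> x \<bullet> (laplacian E \<mu> *v x)"
  unfolding laplacian_quadratic_form[OF assms]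
  using assms by (fastforce intro!: sum_nonneg mult_nonneg_nonneg
      simp: connected_weighted_graph_def neighbourhood_def sym_def)

text \<open>On the kernel the Dirichlet form vanishes, hence so does each of its nonnegative summands; positive weights
then force equal values across every edge, and connectedness spreads this to all vertices.\<close>

lemma laplacian_kernel_constant:
  assumes G: "connected_weighted_graph E \<mu>" and ker: "laplacian E \<mu> *v x = 0"
  shows "x $ i = x $ j"
proof -
  have pos: "0 < \<mu> i j" if "j \<in> neighbourhood E i" for i j
    using G that by (auto simp: connected_weighted_graph_def neighbourhood_def sym_def)
  have "(\<Sum>i\<in>UNIV. \<Sum>j\<in>neighbourhood E i. \<mu> i j * (x $ i - x $ j)\<^sup>2) = 0"
    using laplacian_quadratic_form[OF G, of x] ker by simp
  then have "\<mu> i j * (x $ i - x $ j)\<^sup>2 = 0" if "j \<in> neighbourhood E i" for i j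
    using that pos
    by (subst (asm) sum_nonneg_eq_0_iff; force intro!: sum_nonneg simp: sum_nonneg_eq_0_iff less_imp_le)
  then have edge: "x $ i = x $ j" if "(j, i) \<in> E" for i j
    using that pos by (cases "i = j") (fastforce simp: neighbourhood_def)+
  have "(i, j) \<in> E\<^sup>*" using G by (simp add: connected_weighted_graph_def)
  then show ?thesis by induction (auto dest: edge)
qed

lemma laplacian_symmetric:
  assumes "connected_weighted_graph E \<mu>"
  shows "transpose (laplacian E \<mu>) = laplacian E \<mu>"
  using assms by (auto simp: laplacian_def transpose_def vec_eq_iff connected_weighted_graph_def sym_def)

text \<open>Zero is an eigenvalue because \<open>L *v vec 1 = 0\<close>. It is simple because two orthonormal eigenvectors cannot
both be constant. The column of \<open>U\<close> that belongs to it is \<open>vec 1\<close> up to normalisation and sign, which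
makes the averaging matrix diagonal in the same basis; this is what lets the mean \<open>\<gamma>\<close> be separated from
the other modes.\<close>

theorem laplacian_diagonalisable:
  fixes E :: "('n::finite \<times> 'n) set"
  assumes G: "connected_weighted_graph E \<mu>"
  obtains U :: "real^'n^'n" and d k0 where "orthogonal_matrix U"
    "laplacian E \<mu> = U ** diagonal_matrix d ** transpose U"
    "d k0 = 0" "\<And>k. k \<noteq> k0 \<Longrightarrow> 0 < d k"
    "(1 / real CARD('n)) *\<^sub>R (\<chi> i j. 1) = U ** diagonal_matrix (\<lambda>k. of_bool (k = k0)) ** transpose U"
proof -
  let ?L = "laplacian E \<mu>"
  obtain U d where U: "orthogonal_matrix U" and L: "?L = U ** diagonal_matrix d ** transpose U"
    using symmetric_matrix_diagonalisable[OF laplacian_symmetric[OF G]] by metis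
  have "?L ** U = U ** diagonal_matrix d ** (transpose U ** U)"
    unfolding L by (simp add: matrix_mul_assoc)
  then have LU: "?L ** U = U ** diagonal_matrix d" using U by (simp add: orthogonal_matrix)
  have eig: "?L *v column k U = d k *\<^sub>R column k U" for k
  proof -
    have "(?L *v column k U) $ i = (?L ** U) $ i $ k" for i
      by (simp add: matrix_vector_mult_def matrix_matrix_mult_def column_def)
    then show ?thesis unfolding LU
      by (simp add: vec_eq_iff matrix_matrix_mult_def diagonal_matrix_def column_def
          if_distrib cong: if_cong)
  qed
  have norm: "column k U \<bullet> column k U = 1" for k
    using U by (simp add: orthogonal_matrix_orthonormal_columns norm_eq_1)
  have orth: "column k U \<bullet> column l U = 0" if "k \<noteq> l" for k l
    using U that by (simp add: orthogonal_matrix_orthonormal_columns orthogonal_def)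
  have nonneg: "0 \<le> d k" for k
    using laplacian_psd[OF G, of "column k U"] by (simp add: eig norm)
  have const: "column k U = (U $ i $ k) *\<^sub>R vec 1" if "d k = 0" for k i
    using laplacian_kernel_constant[OF G, of "column k U"] that
    unfolding eig by (simp add: vec_eq_iff column_def)
  have one: "(vec 1 :: real^'n) \<bullet> vec 1 = real CARD('n)" by (simp add: inner_vec_def)
  have sq: "(U $ i $ k)\<^sup>2 * real CARD('n) = 1" if "d k = 0" for k i
    using norm[of k] const[OF that, of i] one by (simp add: power2_eq_square)
  have "\<exists>k0. d k0 = 0"
  proof (rule ccontr)
    \<comment> \<open>The vector \<open>vec 1\<close> would be orthogonal to the whole eigenbasis.\<close>
    assume nz: "\<nexists>k0. d k0 = 0"
    have "?L *v vec 1 = 0" by (simp add: vec_eq_iff laplacian_mult_component[OF G])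
    then have "d k * (column k U \<bullet> vec 1) = 0" for k
      using dot_lmul_matrix[of "column k U" ?L "vec 1"] laplacian_symmetric[OF G] eig[of k]
      by (metis inner_scaleR_left inner_zero_right transpose_matrix_vector)
    then have "transpose U *v vec 1 = 0"
      using nz by (simp add: vec_eq_iff matrix_vector_mult_def transpose_def inner_vec_def column_def)
    then have "(U ** transpose U) *v vec 1 = 0" by (simp flip: matrix_vector_mul_assoc)
    then have "(vec 1 :: real^'n) = 0" using U by (simp add: orthogonal_matrix_def)
    then show False by (simp add: vec_eq_iff)
  qed
  then obtain k0 where k0: "d k0 = 0" by blast
  have "d k \<noteq> 0" if "k \<noteq> k0" for k
  proof
    assume k: "d k = 0"
    fix i :: 'n
    have "U $ i $ k * U $ i $ k0 * real CARD('n) = 0"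
      using orth[OF that] const[OF k, of i] const[OF k0, of i] one by (simp add: mult_ac)
    then show False using sq[OF k, of i] sq[OF k0, of i] by auto
  qed
  then have pos: "0 < d k" if "k \<noteq> k0" for k using nonneg[of k] that by fastforce
  have "U $ i $ k0 * U $ j $ k0 = 1 / real CARD('n)" for i j
  proof -
    have "U $ i $ k0 = U $ j $ k0"
      using const[OF k0, of j] by (simp add: vec_eq_iff column_def)
    then show ?thesis using sq[OF k0, of j] by (simp add: power2_eq_square field_simps)
  qed
  moreover have "(\<Sum>k\<in>UNIV. U $ i $ k * of_bool (k = k0) * U $ j $ k) =
    (\<Sum>k\<in>UNIV. if k = k0 then U $ i $ k0 * U $ j $ k0 else 0)" for i j
    by (rule sum.cong) auto
  ultimately have "(1 / real CARD('n)) *\<^sub>R (\<chi> i j. 1) = U ** diagonal_matrix (\<lambda>k. of_bool (k = k0)) ** transpose U"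
    by (simp add: vec_eq_iff orthogonal_conjugate_component)
  with U L k0 pos show ?thesis by (rule that)
qed

section \<open>Time integrals of processes with continuous paths\<close>

text \<open>Joint measurability is what Fubini's theorem requires. Continuity makes \<open>W\<close> the pointwise limit of its
samplings at the grid points \<open>\<lfloor>n s\<rfloor> / n\<close>, and a sampling only involves countably many of the random
variables \<open>W r\<close>.\<close>

lemma jointly_measurable_of_continuous_paths:
  fixes W :: "real \<Rightarrow> 'a \<Rightarrow> real"
  assumes [measurable]: "\<And>s. W s \<in> borel_measurable M"
    and cont: "\<And>\<omega>. \<omega> \<in> space M \<Longrightarrow> continuous_on UNIV (\<lambda>s. W s \<omega>)"
  shows "(\<lambda>(s, \<omega>). W s \<omega>) \<in> borel_measurable (borel \<Otimes>\<^sub>M M)"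
proof (rule borel_measurable_LIMSEQ_real)
  let ?r = "\<lambda>n s. real_of_int \<lfloor>real (Suc n) * s\<rfloor> / real (Suc n)"
  have r: "(\<lambda>n. ?r n s) \<longlonglongrightarrow> s" for s
  proof (rule Lim_transform2[OF tendsto_const], rule Lim_null_comparison)
    show "\<forall>\<^sub>F n in sequentially. norm (s - ?r n s) \<le> inverse (real (Suc n))"
    proof (rule always_eventually, rule allI)
      fix n
      have "s - ?r n s = (real (Suc n) * s - real_of_int \<lfloor>real (Suc n) * s\<rfloor>) / real (Suc n)"
        by (simp add: diff_divide_distrib)
      moreover have "\<bar>real (Suc n) * s - real_of_int \<lfloor>real (Suc n) * s\<rfloor>\<bar> \<le> 1" by linarith
      ultimately show "norm (s - ?r n s) \<le> inverse (real (Suc n))"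
        by (simp add: divide_right_mono inverse_eq_divide del: of_nat_Suc)
    qed
  qed (rule LIMSEQ_inverse_real_of_nat)
  show "(\<lambda>n. (case p of (s, \<omega>) \<Rightarrow> W (?r n s) \<omega>)) \<longlonglongrightarrow> (case p of (s, \<omega>) \<Rightarrow> W s \<omega>)"
    if "p \<in> space (borel \<Otimes>\<^sub>M M)" for p
  proof -
    obtain s \<omega> where p: "p = (s, \<omega>)" by force
    then have "isCont (\<lambda>s. W s \<omega>) s"
      using that cont[of \<omega>] by (auto simp: space_pair_measure continuous_on_eq_continuous_at)
    from isCont_tendsto_compose[OF this r] show ?thesis by (simp add: p)
  qed
  show "(\<lambda>p. case p of (s, \<omega>) \<Rightarrow> W (?r n s) \<omega>) \<in> borel_measurable (borel \<Otimes>\<^sub>M M)" for n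
  proof -
    have "(\<lambda>p. (\<lambda>k p. W (real_of_int k / real (Suc n)) (snd p)) \<lfloor>real (Suc n) * fst p\<rfloor> p)
        \<in> borel_measurable (borel \<Otimes>\<^sub>M M)"
      by (rule measurable_compose_countable) measurable
    then show ?thesis by (simp add: case_prod_beta)
  qed
qed

lemma integrable_mult_of_squares:
  fixes X Y :: "'a \<Rightarrow> real"
  assumes [measurable]: "X \<in> borel_measurable M" "Y \<in> borel_measurable M"
    and sq: "integrable M (\<lambda>\<omega>. (X \<omega>)\<^sup>2)" "integrable M (\<lambda>\<omega>. (Y \<omega>)\<^sup>2)"
  shows "integrable M (\<lambda>\<omega>. X \<omega> * Y \<omega>)"
    "(\<integral>\<omega>. \<bar>X \<omega> * Y \<omega>\<bar> \<partial>M) \<le> (\<integral>\<omega>. (X \<omega>)\<^sup>2 \<partial>M) + (\<integral>\<omega>. (Y \<omega>)\<^sup>2 \<partial>M)"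
proof -
  have bound: "\<bar>X \<omega> * Y \<omega>\<bar> \<le> (X \<omega>)\<^sup>2 + (Y \<omega>)\<^sup>2" for \<omega>
  proof -
    have "2 * \<bar>X \<omega> * Y \<omega>\<bar> \<le> (X \<omega>)\<^sup>2 + (Y \<omega>)\<^sup>2"
      using sum_squares_bound[of "\<bar>X \<omega>\<bar>" "\<bar>Y \<omega>\<bar>"] by (simp add: abs_mult)
    then show ?thesis by (smt (verit) abs_ge_zero)
  qed
  show *: "integrable M (\<lambda>\<omega>. X \<omega> * Y \<omega>)"
    by (rule Bochner_Integration.integrable_bound[OF Bochner_Integration.integrable_add[OF sq]])
      (use bound in auto)
  have "(\<integral>\<omega>. \<bar>X \<omega> * Y \<omega>\<bar> \<partial>M) \<le> (\<integral>\<omega>. (X \<omega>)\<^sup>2 + (Y \<omega>)\<^sup>2 \<partial>M)"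
    by (intro integral_mono bound Bochner_Integration.integrable_add sq integrable_abs *)
  then show "(\<integral>\<omega>. \<bar>X \<omega> * Y \<omega>\<bar> \<partial>M) \<le> (\<integral>\<omega>. (X \<omega>)\<^sup>2 \<partial>M) + (\<integral>\<omega>. (Y \<omega>)\<^sup>2 \<partial>M)"
    using sq by simp
qed

text \<open>The Cauchy-Schwarz inequality against the constant function, from the nonnegativity of the integral of
\<open>(h s - a)\<^sup>2\<close> where \<open>a\<close> is the mean value of \<open>h\<close>.\<close>

lemma square_integral_le:
  fixes h :: "real \<Rightarrow> real"
  assumes "continuous_on {0..t} h" "0 < t"
  shows "(integral {0..t} h)\<^sup>2 \<le> t * integral {0..t} (\<lambda>s. (h s)\<^sup>2)"
proof -
  define a where "a = integral {0..t} h / t"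
  have "0 \<le> integral {0..t} (\<lambda>s. (h s - a)\<^sup>2)"
    by (intro Henstock_Kurzweil_Integration.integral_nonneg integrable_continuous_interval continuous_intros assms) auto
  also have "\<dots> = integral {0..t} (\<lambda>s. (h s)\<^sup>2 - 2 * a * h s + a\<^sup>2)"
    by (simp add: power2_eq_square algebra_simps)
  also have "\<dots> = integral {0..t} (\<lambda>s. (h s)\<^sup>2) - 2 * a * integral {0..t} h + t * a\<^sup>2"
    using assms
    by (subst Henstock_Kurzweil_Integration.integral_add
           | subst Henstock_Kurzweil_Integration.integral_diff
           | intro integrable_continuous_interval continuous_intros assms
           | simp)+
  also have "\<dots> = integral {0..t} (\<lambda>s. (h s)\<^sup>2) - (integral {0..t} h)\<^sup>2 / t"
    using assms(2) by (simp add: a_def power2_eq_square field_simps)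
  finally show ?thesis using assms(2) by (simp add: field_simps)
qed

text \<open>Expectation and time integration commute for a process with continuous paths and bounded second moments.
The second part has to come first in the applications: there \<open>Y\<close> itself contains the time integral, so
that its square integrability must be known before the third part can be used.\<close>

lemma (in prob_space) time_integral_moments:
  fixes W :: "real \<Rightarrow> 'a \<Rightarrow> real"
  assumes W[measurable]: "\<And>s. W s \<in> borel_measurable M"
    and cont: "\<And>\<omega>. \<omega> \<in> space M \<Longrightarrow> continuous_on UNIV (\<lambda>s. W s \<omega>)"
    and sq: "\<And>s. s \<in> {0..t} \<Longrightarrow> integrable M (\<lambda>\<omega>. (W s \<omega>)\<^sup>2)"
    and K: "\<And>s. s \<in> {0..t} \<Longrightarrow> expectation (\<lambda>\<omega>. (W s \<omega>)\<^sup>2) \<le> K"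
    and g: "continuous_on {0..t} g" and t: "0 < t"
  shows "(\<lambda>\<omega>. integral {0..t} (\<lambda>s. g s * W s \<omega>)) \<in> borel_measurable M" (is "?Z \<in> _")
    and "integrable M (\<lambda>\<omega>. (integral {0..t} (\<lambda>s. g s * W s \<omega>))\<^sup>2)"
    and "\<lbrakk>Y \<in> borel_measurable M; integrable M (\<lambda>\<omega>. (Y \<omega>)\<^sup>2)\<rbrakk> \<Longrightarrow>
      expectation (\<lambda>\<omega>. Y \<omega> * integral {0..t} (\<lambda>s. g s * W s \<omega>)) =
      integral {0..t} (\<lambda>s. g s * expectation (\<lambda>\<omega>. Y \<omega> * W s \<omega>))"
proof -
  interpret P: pair_sigma_finite lborel M
    by (intro pair_sigma_finite.intro sigma_finite_lborel sigma_finite_measure_axioms)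
  \<comment> \<open>Extending the kernel by zero turns integrals over \<open>{0..t}\<close> into integrals over the line.\<close>
  define G where "G s = indicator {0..t} s * g s" for s
  have G[measurable]: "G \<in> borel_measurable borel"
    unfolding G_def using borel_measurable_continuous_on_indicator[OF _ g] by simp
  have W2[measurable]: "(\<lambda>(s, \<omega>). W s \<omega>) \<in> borel_measurable (borel \<Otimes>\<^sub>M M)"
    by (rule jointly_measurable_of_continuous_paths[OF W cont])
  have GW[measurable]: "(\<lambda>(s, \<omega>). G s * W s \<omega>) \<in> borel_measurable (lborel \<Otimes>\<^sub>M M)"
    by measurable
  have WG[measurable]: "(\<lambda>(\<omega>, s). G s * W s \<omega>) \<in> borel_measurable (M \<Otimes>\<^sub>M lborel)"
    by measurable
  have cont': "continuous_on {0..t} (\<lambda>s. g s * W s \<omega>)" if "\<omega> \<in> space M" for \<omega>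
    by (intro continuous_intros g continuous_on_subset[OF cont[OF that]]) auto
  have Gint: "integrable lborel (\<lambda>s. indicator {0..t} s * h s)" "(\<integral>s. indicator {0..t} s * h s \<partial>lborel) = integral {0..t} h"
    if "continuous_on {0..t} h" for h :: "real \<Rightarrow> real"
  proof -
    have *: "set_integrable lborel {0..t} h" using borel_integrable_atLeastAtMost'[OF that] .
    then show "integrable lborel (\<lambda>s. indicator {0..t} s * h s)" by (simp add: set_integrable_def)
    show "(\<integral>s. indicator {0..t} s * h s \<partial>lborel) = integral {0..t} h"
      using set_borel_integral_eq_integral(2)[OF *] by (simp add: set_lebesgue_integral_def)
  qed
  have Z: "?Z \<omega> = (\<integral>s. G s * W s \<omega> \<partial>lborel)" if "\<omega> \<in> space M" for \<omega>
    using Gint(2)[OF cont'[OF that]] by (simp add: G_def mult_ac)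
  show Zm[measurable]: "?Z \<in> borel_measurable M"
    by (subst measurable_cong[OF Z]) measurable
  have G2: "integrable lborel (\<lambda>s. (G s)\<^sup>2)"
  proof -
    have "integrable lborel (\<lambda>s. indicator {0..t} s * (g s)\<^sup>2)"
      by (intro Gint continuous_intros g)
    also have "(\<lambda>s. indicator {0..t} s * (g s)\<^sup>2) = (\<lambda>s. (G s)\<^sup>2)"
      by (auto simp: G_def indicator_def fun_eq_iff)
    finally show ?thesis .
  qed
  have G1: "integrable lborel G" unfolding G_def by (intro Gint g)
  have int2: "integrable M (\<lambda>\<omega>. (G s * W s \<omega>)\<^sup>2)" for s
    using sq[of s] by (cases "s \<in> {0..t}") (auto simp: G_def power_mult_distrib)
  have "integrable (lborel \<Otimes>\<^sub>M M) (\<lambda>(s, \<omega>). (G s * W s \<omega>)\<^sup>2)"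
  proof (rule P.Fubini_integrable)
    show "integrable lborel (\<lambda>s. \<integral>\<omega>. norm (case (s, \<omega>) of (s, \<omega>) \<Rightarrow> (G s * W s \<omega>)\<^sup>2) \<partial>M)"
    proof (rule Bochner_Integration.integrable_bound)
      show "integrable lborel (\<lambda>s. (G s)\<^sup>2 * K)" using G2 by simp
      have "(\<integral>\<omega>. (G s * W s \<omega>)\<^sup>2 \<partial>M) \<le> (G s)\<^sup>2 * K" for s
      proof (cases "s \<in> {0..t}")
        case True
        then show ?thesis using K[OF True] by (simp add: power_mult_distrib mult_left_mono)
      qed (simp add: G_def)
      then show "AE s in lborel. norm (\<integral>\<omega>. norm (case (s, \<omega>) of (s, \<omega>) \<Rightarrow> (G s * W s \<omega>)\<^sup>2) \<partial>M) \<le> norm ((G s)\<^sup>2 * K)"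
        by (auto intro!: always_eventually order_trans[OF _ abs_ge_self])
    qed measurable
  qed (use int2 in auto)
  then have V: "integrable M (\<lambda>\<omega>. \<integral>s. (G s * W s \<omega>)\<^sup>2 \<partial>lborel)"
    by (rule P.integrable_snd)
  have ZV: "(?Z \<omega>)\<^sup>2 \<le> t * (\<integral>s. (G s * W s \<omega>)\<^sup>2 \<partial>lborel)" if "\<omega> \<in> space M" for \<omega>
  proof -
    have "(\<integral>s. (G s * W s \<omega>)\<^sup>2 \<partial>lborel) = (\<integral>s. indicator {0..t} s * (g s * W s \<omega>)\<^sup>2 \<partial>lborel)"
      by (intro Bochner_Integration.integral_cong) (auto simp: G_def indicator_def)
    also have "\<dots> = integral {0..t} (\<lambda>s. (g s * W s \<omega>)\<^sup>2)"
      by (intro Gint(2) continuous_on_power cont'[OF that])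
    finally show ?thesis using square_integral_le[OF cont'[OF that] t] by simp
  qed
  show "integrable M (\<lambda>\<omega>. (?Z \<omega>)\<^sup>2)"
    by (rule Bochner_Integration.integrable_bound[OF integrable_mult_right[OF V, of t]])
      (use ZV in \<open>auto intro!: order_trans[OF _ abs_ge_self]\<close>)
  assume Y[measurable]: "Y \<in> borel_measurable M" and Y2: "integrable M (\<lambda>\<omega>. (Y \<omega>)\<^sup>2)"
  have YW: "integrable M (\<lambda>\<omega>. Y \<omega> * W s \<omega>)"
    "(\<integral>\<omega>. \<bar>Y \<omega> * W s \<omega>\<bar> \<partial>M) \<le> expectation (\<lambda>\<omega>. (Y \<omega>)\<^sup>2) + K" if "s \<in> {0..t}" for s
    using integrable_mult_of_squares[OF Y W Y2 sq[OF that]] K[OF that] by auto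
  have YGW: "integrable M (\<lambda>\<omega>. G s * (Y \<omega> * W s \<omega>))" for s
    using YW(1)[of s] by (cases "s \<in> {0..t}") (auto simp: G_def)
  have joint: "integrable (lborel \<Otimes>\<^sub>M M) (\<lambda>(s, \<omega>). G s * (Y \<omega> * W s \<omega>))"
  proof (rule P.Fubini_integrable)
    show "integrable lborel (\<lambda>s. \<integral>\<omega>. norm (case (s, \<omega>) of (s, \<omega>) \<Rightarrow> G s * (Y \<omega> * W s \<omega>)) \<partial>M)"
    proof (rule Bochner_Integration.integrable_bound)
      show "integrable lborel (\<lambda>s. G s * (expectation (\<lambda>\<omega>. (Y \<omega>)\<^sup>2) + K))" using G1 by simp
      have "(\<integral>\<omega>. \<bar>G s * (Y \<omega> * W s \<omega>)\<bar> \<partial>M) \<le> \<bar>G s * (expectation (\<lambda>\<omega>. (Y \<omega>)\<^sup>2) + K)\<bar>" for s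
      proof (cases "s \<in> {0..t}")
        case True
        have "(\<integral>\<omega>. \<bar>G s * (Y \<omega> * W s \<omega>)\<bar> \<partial>M) = \<bar>G s\<bar> * (\<integral>\<omega>. \<bar>Y \<omega> * W s \<omega>\<bar> \<partial>M)"
          by (simp add: abs_mult[of "G s"])
        also have "\<dots> \<le> \<bar>G s\<bar> * \<bar>expectation (\<lambda>\<omega>. (Y \<omega>)\<^sup>2) + K\<bar>"
          using YW(2)[OF True] by (intro mult_left_mono) auto
        finally show ?thesis by (simp add: abs_mult)
      qed (simp add: G_def)
      then show "AE s in lborel. norm (\<integral>\<omega>. norm (case (s, \<omega>) of (s, \<omega>) \<Rightarrow> G s * (Y \<omega> * W s \<omega>)) \<partial>M)
          \<le> norm (G s * (expectation (\<lambda>\<omega>. (Y \<omega>)\<^sup>2) + K))"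
        by (auto intro!: always_eventually)
    qed measurable
  qed (use YGW in auto)
  have "expectation (\<lambda>\<omega>. Y \<omega> * ?Z \<omega>) = (\<integral>\<omega>. (\<integral>s. G s * (Y \<omega> * W s \<omega>) \<partial>lborel) \<partial>M)"
  proof (rule Bochner_Integration.integral_cong[OF refl])
    fix \<omega> assume "\<omega> \<in> space M"
    have "(\<integral>s. G s * (Y \<omega> * W s \<omega>) \<partial>lborel) = (\<integral>s. Y \<omega> * (G s * W s \<omega>) \<partial>lborel)"
      by (simp add: mult_ac)
    then show "Y \<omega> * ?Z \<omega> = (\<integral>s. G s * (Y \<omega> * W s \<omega>) \<partial>lborel)"
      using Z[OF \<open>\<omega> \<in> space M\<close>] by simp
  qed
  also have "\<dots> = (\<integral>s. (\<integral>\<omega>. G s * (Y \<omega> * W s \<omega>) \<partial>M) \<partial>lborel)"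
    by (rule P.Fubini_integral[OF joint])
  also have "\<dots> = (\<integral>s. indicator {0..t} s * (g s * expectation (\<lambda>\<omega>. Y \<omega> * W s \<omega>)) \<partial>lborel)"
    by (simp add: G_def mult.assoc)
  also have "\<dots> = integral {0..t} (\<lambda>s. g s * expectation (\<lambda>\<omega>. Y \<omega> * W s \<omega>))"
  proof -
    have "integrable lborel (\<lambda>s. \<integral>\<omega>. G s * (Y \<omega> * W s \<omega>) \<partial>M)"
      by (rule P.integrable_fst[OF joint])
    then have "set_integrable lborel {0..t} (\<lambda>s. g s * expectation (\<lambda>\<omega>. Y \<omega> * W s \<omega>))"
      by (simp add: set_integrable_def G_def mult.assoc)
    from set_borel_integral_eq_integral(2)[OF this] show ?thesis
      by (simp add: set_lebesgue_integral_def)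
  qed
  finally show "expectation (\<lambda>\<omega>. Y \<omega> * ?Z \<omega>) = integral {0..t} (\<lambda>s. g s * expectation (\<lambda>\<omega>. Y \<omega> * W s \<omega>))" .
qed

section \<open>Second moments of a scalar linear equation\<close>

text \<open>Variance at time \<open>t\<close> of the solution of \<open>dy = - m y dt + dw\<close>, \<open>y 0 = 0\<close>. The value at \<open>m = 0\<close> is the limit
\<open>m \<rightarrow> 0\<close>: the solution is then the Wiener process itself.\<close>

definition ou_variance :: "real \<Rightarrow> real \<Rightarrow> real" where
  "ou_variance m t = (if m = 0 then t else (1 - exp (- 2 * m * t)) / (2 * m))"

text \<open>With \<open>N = w t - m * \<integral> exp (- m * (t - u)) * w u du\<close>, where \<open>w\<close> is a Wiener process, the difference
in brackets on the left is the covariance of \<open>N\<close> and \<open>w s\<close>. The integral is split at \<open>s\<close>, where the minimum changes its branch.\<close>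

lemma kernel_min_integral:
  fixes s t m :: real
  assumes s: "0 \<le> s" "s \<le> t" and m: "m \<noteq> 0"
  shows "m * (s - m * integral {0..t} (\<lambda>u. exp (- m * (t - u)) * min s u)) =
    exp (- m * (t - s)) - exp (- m * t)"
proof -
  let ?g = "\<lambda>u. exp (- m * (t - u))"
  have "((\<lambda>u. ?g u * u) has_integral
      ((s * ?g s / m - ?g s / m\<^sup>2) - (0 * ?g 0 / m - ?g 0 / m\<^sup>2))) {0..s}"
    using s m
    by (intro fundamental_theorem_of_calculus)
      (auto intro!: derivative_eq_intros simp flip: has_real_derivative_iff_has_vector_derivative
        simp: field_simps power2_eq_square)
  then have 1: "((\<lambda>u. ?g u * min s u) has_integral
      ((s * ?g s / m - ?g s / m\<^sup>2) + ?g 0 / m\<^sup>2)) {0..s}"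
    by (subst has_integral_cong[of _ _ "\<lambda>u. ?g u * u"]) (auto simp: min_def)
  have "((\<lambda>u. ?g u * s) has_integral (s * ?g t / m - s * ?g s / m)) {s..t}"
    using s m
    by (intro fundamental_theorem_of_calculus)
      (auto intro!: derivative_eq_intros simp flip: has_real_derivative_iff_has_vector_derivative
        simp: field_simps power2_eq_square)
  then have 2: "((\<lambda>u. ?g u * min s u) has_integral (s * ?g t / m - s * ?g s / m)) {s..t}"
    by (subst has_integral_cong[of _ _ "\<lambda>u. ?g u * s"]) (auto simp: min_def)
  have "integral {0..t} (\<lambda>u. ?g u * min s u) =
    (s * ?g s / m - ?g s / m\<^sup>2) + ?g 0 / m\<^sup>2 + (s * ?g t / m - s * ?g s / m)"
    using has_integral_combine[OF s 1 2] by (rule integral_unique)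
  then show ?thesis using m by (simp add: field_simps power2_eq_square)
qed

text \<open>The left-hand side is \<open>m\<close> times the second moment of the same \<open>N\<close>, with the covariances from
\<open>kernel_min_integral\<close> inserted.\<close>

lemma kernel_variance_integral:
  fixes t m :: real
  assumes "0 \<le> t"
  shows "(1 - exp (- m * t)) - m * integral {0..t} (\<lambda>s. exp (- m * (t - s)) * (exp (- m * (t - s)) - exp (- m * t)))
    = (1 - exp (- 2 * m * t)) / 2"
proof (cases "m = 0")
  case False
  let ?g = "\<lambda>u. exp (- m * (t - u))"
  have "((\<lambda>s. ?g s * (?g s - ?g 0)) has_integral
      ((?g t * ?g t / (2 * m) - ?g t * ?g 0 / m) - (?g 0 * ?g 0 / (2 * m) - ?g 0 * ?g 0 / m))) {0..t}"
    using assms False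
    by (intro fundamental_theorem_of_calculus)
      (auto intro!: derivative_eq_intros simp flip: has_real_derivative_iff_has_vector_derivative
        simp: field_simps power2_eq_square)
  then have "m * integral {0..t} (\<lambda>s. ?g s * (?g s - ?g 0)) = 1 / 2 - ?g 0 + ?g 0 * ?g 0 / 2"
    using False by (simp add: integral_unique field_simps)
  moreover have "exp (- 2 * m * t) = ?g 0 * ?g 0" by (simp flip: exp_add)
  ultimately show ?thesis by (simp add: field_simps)
qed simp

text \<open>Variation of constants for a path. Here \<open>w\<close> is merely continuous, so the equation for \<open>y\<close> cannot be
differentiated; its primitive \<open>s \<mapsto> integral {0..s} y\<close> is differentiable, however, and the integrating factor
\<open>exp (m s)\<close> is applied to it. The term in \<open>w\<close> is what an integration by parts
makes of the stochastic convolution; it contains no stochastic integral.\<close>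

lemma linear_integral_equation_solution:
  fixes y w :: "real \<Rightarrow> real"
  assumes y: "continuous_on {0..} y" and w: "continuous_on {0..} w"
    and eq: "\<And>s. 0 \<le> s \<Longrightarrow> y s = x0 - m * integral {0..s} y + a * w s" and t: "0 \<le> t"
  shows "y t = exp (- m * t) * x0 + a * (w t - m * integral {0..t} (\<lambda>s. exp (- m * (t - s)) * w s))"
proof -
  let ?I = "\<lambda>s. integral {0..s} y"
  have w': "continuous_on {0..t} w" using w by (rule continuous_on_subset) auto
  have der: "((\<lambda>s. exp (m * s) * ?I s) has_real_derivative exp (m * s) * (x0 + a * w s)) (at s within {0..t})"
    if "s \<in> {0..t}" for s
  proof -
    have "(?I has_real_derivative y s) (at s within {0..t})"
      using that by (intro integral_has_real_derivative continuous_on_subset[OF y]) auto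
    then have "((\<lambda>s. exp (m * s) * ?I s) has_real_derivative exp (m * s) * (m * ?I s + y s)) (at s within {0..t})"
      by (auto intro!: derivative_eq_intros simp: algebra_simps)
    then show ?thesis using eq[of s] that by simp
  qed
  have "((\<lambda>s. exp (m * s) * (x0 + a * w s)) has_integral (exp (m * t) * ?I t - exp (m * 0) * ?I 0)) {0..t}"
    using t der by (intro fundamental_theorem_of_calculus)
      (auto simp flip: has_real_derivative_iff_has_vector_derivative)
  from has_integral_mult_right[OF this, of m]
  have "((\<lambda>s. m * exp (m * s) * (x0 + a * w s)) has_integral m * (exp (m * t) * ?I t)) {0..t}"
    by (simp add: mult_ac)
  moreover have "((\<lambda>s. m * exp (m * s) * x0) has_integral (exp (m * t) * x0 - exp (m * 0) * x0)) {0..t}"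
    using t by (intro fundamental_theorem_of_calculus)
      (auto intro!: derivative_eq_intros simp flip: has_real_derivative_iff_has_vector_derivative)
  ultimately have "((\<lambda>s. m * exp (m * s) * (x0 + a * w s) - m * exp (m * s) * x0) has_integral
      (m * (exp (m * t) * ?I t) - (exp (m * t) * x0 - exp (m * 0) * x0))) {0..t}"
    by (rule has_integral_diff)
  from has_integral_mult_right[OF this, of "exp (- m * t)"]
  have "((\<lambda>s. exp (- m * t) * (m * exp (m * s) * (x0 + a * w s) - m * exp (m * s) * x0)) has_integral
      exp (- m * t) * (m * (exp (m * t) * ?I t) - (exp (m * t) * x0 - exp (m * 0) * x0))) {0..t}" .
  moreover have "exp (- m * t) * (m * exp (m * s) * (x0 + a * w s) - m * exp (m * s) * x0) =
      m * a * (exp (- m * (t - s)) * w s)" for s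
  proof -
    have "exp (- m * (t - s)) = exp (- m * t) * exp (m * s)"
      unfolding exp_add[symmetric] by (simp add: algebra_simps)
    then show ?thesis by (simp add: algebra_simps)
  qed
  moreover have "exp (- m * t) * (m * (exp (m * t) * ?I t) - (exp (m * t) * x0 - exp (m * 0) * x0)) =
      m * ?I t - x0 + exp (- m * t) * x0"
  proof -
    have "exp (- m * t) * exp (m * t) = 1" by (simp flip: exp_add)
    moreover have "exp (- m * t) * (m * (exp (m * t) * ?I t) - (exp (m * t) * x0 - exp (m * 0) * x0)) =
      (exp (- m * t) * exp (m * t)) * (m * ?I t - x0) + exp (- m * t) * x0"
      by (simp add: algebra_simps)
    ultimately show ?thesis by simp
  qed
  ultimately have "((\<lambda>s. m * a * (exp (- m * (t - s)) * w s)) has_integral (m * ?I t - x0 + exp (- m * t) * x0)) {0..t}"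
    by simp
  then have "integral {0..t} (\<lambda>s. m * a * (exp (- m * (t - s)) * w s)) = m * ?I t - x0 + exp (- m * t) * x0"
    by (rule integral_unique)
  then have "m * a * integral {0..t} (\<lambda>s. exp (- m * (t - s)) * w s) = m * ?I t - x0 + exp (- m * t) * x0"
    by (simp only: integral_mult_right)
  then show ?thesis using eq[OF t] by (simp add: algebra_simps)
qed

text \<open>The variable \<open>N\<close> is the stochastic integral of \<open>exp (- m * (t - s))\<close> against \<open>W\<close>, integrated by parts.
Exchanging expectation and time integral in \<open>E[W s * N]\<close> gives the covariance of \<open>N\<close> with each \<open>W s\<close>; the
same exchange in \<open>E[N * N]\<close> then expresses the second moment of \<open>N\<close> by these covariances.\<close>

lemma (in prob_space) ornstein_uhlenbeck_moments:
  fixes W :: "real \<Rightarrow> 'a \<Rightarrow> real" and m :: real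
  assumes W[measurable]: "\<And>s. W s \<in> borel_measurable M"
    and cont: "\<And>\<omega>. \<omega> \<in> space M \<Longrightarrow> continuous_on UNIV (\<lambda>s. W s \<omega>)"
    and sq: "\<And>s. 0 \<le> s \<Longrightarrow> integrable M (\<lambda>\<omega>. (W s \<omega>)\<^sup>2)"
    and cov: "\<And>s u. 0 \<le> s \<Longrightarrow> 0 \<le> u \<Longrightarrow> expectation (\<lambda>\<omega>. W s \<omega> * W u \<omega>) = min s u"
    and X[measurable]: "X \<in> borel_measurable M" and X2: "integrable M (\<lambda>\<omega>. (X \<omega>)\<^sup>2)"
    and XW: "\<And>s. 0 \<le> s \<Longrightarrow> expectation (\<lambda>\<omega>. X \<omega> * W s \<omega>) = 0"
    and t: "0 < t"
  defines "N \<equiv> \<lambda>\<omega>. W t \<omega> - m * integral {0..t} (\<lambda>s. exp (- m * (t - s)) * W s \<omega>)"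
  shows "N \<in> borel_measurable M" "integrable M (\<lambda>\<omega>. (N \<omega>)\<^sup>2)"
    "expectation (\<lambda>\<omega>. (N \<omega>)\<^sup>2) = ou_variance m t"
    "expectation (\<lambda>\<omega>. X \<omega> * N \<omega>) = 0"
proof -
  let ?g = "\<lambda>s. exp (- m * (t - s))"
  define Z where "Z \<omega> = integral {0..t} (\<lambda>s. ?g s * W s \<omega>)" for \<omega>
  have N: "N \<omega> = W t \<omega> - m * Z \<omega>" for \<omega> by (simp add: N_def Z_def)
  have K: "expectation (\<lambda>\<omega>. (W s \<omega>)\<^sup>2) \<le> t" if "s \<in> {0..t}" for s
    using cov[of s s] that by (simp add: power2_eq_square)
  have g: "continuous_on {0..t} ?g" by (intro continuous_intros)
  have sq': "integrable M (\<lambda>\<omega>. (W s \<omega>)\<^sup>2)" if "s \<in> {0..t}" for s using sq that by simp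
  have Z[measurable]: "Z \<in> borel_measurable M"
    unfolding Z_def by (rule time_integral_moments(1)[OF W cont sq' K g t])
  have Z2: "integrable M (\<lambda>\<omega>. (Z \<omega>)\<^sup>2)"
    unfolding Z_def by (rule time_integral_moments(2)[OF W cont sq' K g t])
  have EZ: "expectation (\<lambda>\<omega>. Y \<omega> * Z \<omega>) = integral {0..t} (\<lambda>s. ?g s * expectation (\<lambda>\<omega>. Y \<omega> * W s \<omega>))"
    if "Y \<in> borel_measurable M" "integrable M (\<lambda>\<omega>. (Y \<omega>)\<^sup>2)" for Y
    unfolding Z_def by (rule time_integral_moments(3)[OF W cont sq' K g t]) (use that in auto)
  show Nm[measurable]: "N \<in> borel_measurable M" unfolding N by measurable
  have WZ: "integrable M (\<lambda>\<omega>. W s \<omega> * Z \<omega>)" if "0 \<le> s" for s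
    by (rule integrable_mult_of_squares(1)[OF W Z sq[OF that] Z2])
  have "integrable M (\<lambda>\<omega>. (W t \<omega>)\<^sup>2 - 2 * m * (W t \<omega> * Z \<omega>) + m\<^sup>2 * (Z \<omega>)\<^sup>2)"
    using t by (intro Bochner_Integration.integrable_add Bochner_Integration.integrable_diff
        integrable_mult_right sq WZ Z2) auto
  also have "(\<lambda>\<omega>. (W t \<omega>)\<^sup>2 - 2 * m * (W t \<omega> * Z \<omega>) + m\<^sup>2 * (Z \<omega>)\<^sup>2) = (\<lambda>\<omega>. (N \<omega>)\<^sup>2)"
    by (simp add: N power2_eq_square algebra_simps fun_eq_iff)
  finally show N2: "integrable M (\<lambda>\<omega>. (N \<omega>)\<^sup>2)" .
  have EYN: "expectation (\<lambda>\<omega>. Y \<omega> * N \<omega>) = expectation (\<lambda>\<omega>. Y \<omega> * W t \<omega>)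
      - m * integral {0..t} (\<lambda>s. ?g s * expectation (\<lambda>\<omega>. Y \<omega> * W s \<omega>))"
    if Y: "Y \<in> borel_measurable M" "integrable M (\<lambda>\<omega>. (Y \<omega>)\<^sup>2)" for Y
  proof -
    have "expectation (\<lambda>\<omega>. Y \<omega> * N \<omega>) = expectation (\<lambda>\<omega>. Y \<omega> * W t \<omega> - m * (Y \<omega> * Z \<omega>))"
      by (simp add: N algebra_simps)
    also have "\<dots> = expectation (\<lambda>\<omega>. Y \<omega> * W t \<omega>) - m * expectation (\<lambda>\<omega>. Y \<omega> * Z \<omega>)"
      using integrable_mult_of_squares(1)[OF Y(1) W Y(2) sq, of t]
        integrable_mult_of_squares(1)[OF Y(1) Z Y(2) Z2] t by simp
    finally show ?thesis using EZ[OF Y] by simp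
  qed
  have "integral {0..t} (\<lambda>s. ?g s * expectation (\<lambda>\<omega>. X \<omega> * W s \<omega>)) = integral {0..t} (\<lambda>s. 0)"
    by (rule Henstock_Kurzweil_Integration.integral_cong) (simp add: XW)
  then show "expectation (\<lambda>\<omega>. X \<omega> * N \<omega>) = 0" using EYN[OF X X2] XW t by simp
  have EWN: "expectation (\<lambda>\<omega>. N \<omega> * W s \<omega>) =
      s - m * integral {0..t} (\<lambda>u. ?g u * min s u)" if s: "s \<in> {0..t}" for s
  proof -
    have "integral {0..t} (\<lambda>u. ?g u * expectation (\<lambda>\<omega>. W s \<omega> * W u \<omega>)) = integral {0..t} (\<lambda>u. ?g u * min s u)"
      using s by (intro Henstock_Kurzweil_Integration.integral_cong) (simp add: cov)
    then show ?thesis using EYN[OF W sq, of s] cov[of s t] s by (simp add: mult.commute)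
  qed
  have N2eq: "expectation (\<lambda>\<omega>. (N \<omega>)\<^sup>2) = expectation (\<lambda>\<omega>. N \<omega> * W t \<omega>)
      - m * integral {0..t} (\<lambda>s. ?g s * expectation (\<lambda>\<omega>. N \<omega> * W s \<omega>))"
    using EYN[OF Nm N2] by (simp add: power2_eq_square)
  show "expectation (\<lambda>\<omega>. (N \<omega>)\<^sup>2) = ou_variance m t"
  proof (cases "m = 0")
    case True
    then show ?thesis using N2eq EWN[of t] t by (simp add: ou_variance_def)
  next
    case False
    have mWN: "m * expectation (\<lambda>\<omega>. N \<omega> * W s \<omega>) = ?g s - ?g 0" if "s \<in> {0..t}" for s
      using kernel_min_integral[of s t m] EWN[OF that] that False by simp
    have "m * integral {0..t} (\<lambda>s. ?g s * expectation (\<lambda>\<omega>. N \<omega> * W s \<omega>)) =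
      integral {0..t} (\<lambda>s. ?g s * (m * expectation (\<lambda>\<omega>. N \<omega> * W s \<omega>)))"
      by (simp add: mult.left_commute flip: integral_mult_right)
    also have "\<dots> = integral {0..t} (\<lambda>s. ?g s * (?g s - ?g 0))"
      by (rule Henstock_Kurzweil_Integration.integral_cong) (simp only: mWN)
    finally have "m * expectation (\<lambda>\<omega>. (N \<omega>)\<^sup>2) =
        (?g t - ?g 0) - m * integral {0..t} (\<lambda>s. ?g s * (?g s - ?g 0))"
      using N2eq mWN[of t] t by (simp add: right_diff_distrib)
    also have "\<dots> = (1 - exp (- 2 * m * t)) / 2"
      using kernel_variance_integral[of t m] t by simp
    finally show ?thesis using False by (simp add: ou_variance_def field_simps)
  qed
qed

text \<open>The solution is \<open>exp (- m * t) * X\<close> plus \<open>a\<close> times the variable \<open>N\<close> of \<open>ornstein_uhlenbeck_moments\<close>, and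
these two summands are uncorrelated. The multiple \<open>q\<close> of the initial value is subtracted because the
error of the average mode is measured relative to its initial value.\<close>

lemma (in prob_space) linear_sde_mean_square:
  fixes \<beta> y :: "real \<Rightarrow> 'a \<Rightarrow> real"
  assumes \<beta>: "\<And>s. 0 \<le> s \<Longrightarrow> \<beta> s \<in> borel_measurable M"
    and cont: "AE \<omega> in M. continuous_on {0..} (\<lambda>s. \<beta> s \<omega>)"
    and sq: "\<And>s. 0 \<le> s \<Longrightarrow> integrable M (\<lambda>\<omega>. (\<beta> s \<omega>)\<^sup>2)"
    and cov: "\<And>s u. 0 \<le> s \<Longrightarrow> 0 \<le> u \<Longrightarrow> expectation (\<lambda>\<omega>. \<beta> s \<omega> * \<beta> u \<omega>) = min s u"
    and X[measurable]: "X \<in> borel_measurable M" and X2: "integrable M (\<lambda>\<omega>. (X \<omega>)\<^sup>2)"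
    and X1: "expectation (\<lambda>\<omega>. (X \<omega>)\<^sup>2) = 1"
    and X\<beta>: "\<And>s. 0 \<le> s \<Longrightarrow> expectation (\<lambda>\<omega>. X \<omega> * \<beta> s \<omega>) = 0"
    and y[measurable]: "y t \<in> borel_measurable M"
    and ycont: "AE \<omega> in M. continuous_on {0..} (\<lambda>s. y s \<omega>)"
    and yeq: "AE \<omega> in M. \<forall>s\<ge>0. y s \<omega> = X \<omega> - m * integral {0..s} (\<lambda>u. y u \<omega>) + a * \<beta> s \<omega>"
    and t: "0 < t"
  shows "has_bochner_integral M (\<lambda>\<omega>. (y t \<omega> - q * X \<omega>)\<^sup>2) ((exp (- m * t) - q)\<^sup>2 + a\<^sup>2 * ou_variance m t)"
proof -
  obtain A where A: "{\<omega> \<in> space M. \<not> continuous_on {0..} (\<lambda>s. \<beta> s \<omega>)} \<subseteq> A" "A \<in> sets M" "emeasure M A = 0"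
    using cont by (rule AE_E)
  have notA: "AE \<omega> in M. \<omega> \<notin> A" using A(2,3) by (intro AE_not_in null_setsI) auto
  \<comment> \<open>A version of the noise whose paths are continuous without exception and on the whole line.\<close>
  define W where "W s \<omega> = (if \<omega> \<in> A then 0 else \<beta> (max 0 s) \<omega>)" for s \<omega>
  have W[measurable]: "W s \<in> borel_measurable M" for s
    unfolding W_def using \<beta>[of "max 0 s"] A(2) by measurable
  have Wcont: "continuous_on UNIV (\<lambda>s. W s \<omega>)" if "\<omega> \<in> space M" for \<omega>
  proof (cases "\<omega> \<in> A")
    case False
    then have "continuous_on {0..} (\<lambda>s. \<beta> s \<omega>)" using A(1) that by blast
    then have "continuous_on UNIV (\<lambda>s. \<beta> (max 0 s) \<omega>)"
      by (rule continuous_on_compose2) (auto intro!: continuous_intros)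
    then show ?thesis using False by (simp add: W_def)
  qed (simp add: W_def)
  have WAE: "AE \<omega> in M. W s \<omega> = \<beta> s \<omega>" if "0 \<le> s" for s
    using notA by eventually_elim (use that in \<open>simp add: W_def\<close>)
  have Wsq: "integrable M (\<lambda>\<omega>. (W s \<omega>)\<^sup>2)" if "0 \<le> s" for s
    using sq[OF that] by (rule integrable_cong_AE_imp) (use WAE[OF that] in auto)
  have Wcov: "expectation (\<lambda>\<omega>. W s \<omega> * W u \<omega>) = min s u" if "0 \<le> s" "0 \<le> u" for s u
  proof -
    have "expectation (\<lambda>\<omega>. W s \<omega> * W u \<omega>) = expectation (\<lambda>\<omega>. \<beta> s \<omega> * \<beta> u \<omega>)"
      using WAE[OF that(1)] WAE[OF that(2)] \<beta>[OF that(1)] \<beta>[OF that(2)]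
      by (intro integral_cong_AE) auto
    then show ?thesis using cov[OF that] by simp
  qed
  have XW: "expectation (\<lambda>\<omega>. X \<omega> * W s \<omega>) = 0" if "0 \<le> s" for s
  proof -
    have "expectation (\<lambda>\<omega>. X \<omega> * W s \<omega>) = expectation (\<lambda>\<omega>. X \<omega> * \<beta> s \<omega>)"
      using WAE[OF that] \<beta>[OF that] by (intro integral_cong_AE) auto
    then show ?thesis using X\<beta>[OF that] by simp
  qed
  define N where "N \<omega> = W t \<omega> - m * integral {0..t} (\<lambda>s. exp (- m * (t - s)) * W s \<omega>)" for \<omega>
  have N[measurable]: "N \<in> borel_measurable M"
    unfolding N_def by (rule ornstein_uhlenbeck_moments(1)[OF W Wcont Wsq Wcov X X2 XW t])
  have N2: "integrable M (\<lambda>\<omega>. (N \<omega>)\<^sup>2)"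
    unfolding N_def by (rule ornstein_uhlenbeck_moments(2)[OF W Wcont Wsq Wcov X X2 XW t])
  have EN2: "expectation (\<lambda>\<omega>. (N \<omega>)\<^sup>2) = ou_variance m t"
    unfolding N_def by (rule ornstein_uhlenbeck_moments(3)[OF W Wcont Wsq Wcov X X2 XW t])
  have EXN: "expectation (\<lambda>\<omega>. X \<omega> * N \<omega>) = 0"
    unfolding N_def by (rule ornstein_uhlenbeck_moments(4)[OF W Wcont Wsq Wcov X X2 XW t])
  let ?r = "exp (- m * t) - q"
  have XN: "integrable M (\<lambda>\<omega>. X \<omega> * N \<omega>)"
    by (rule integrable_mult_of_squares(1)[OF X N X2 N2])
  have "has_bochner_integral M (\<lambda>\<omega>. ?r\<^sup>2 * (X \<omega>)\<^sup>2 + 2 * ?r * a * (X \<omega> * N \<omega>) + a\<^sup>2 * (N \<omega>)\<^sup>2)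
      (?r\<^sup>2 * 1 + 2 * ?r * a * 0 + a\<^sup>2 * ou_variance m t)"
    using X1 EN2 EXN X2 XN N2
    by (intro has_bochner_integral_add has_bochner_integral_mult_right) (simp_all add: has_bochner_integral_iff)
  also have "(\<lambda>\<omega>. ?r\<^sup>2 * (X \<omega>)\<^sup>2 + 2 * ?r * a * (X \<omega> * N \<omega>) + a\<^sup>2 * (N \<omega>)\<^sup>2) = (\<lambda>\<omega>. (?r * X \<omega> + a * N \<omega>)\<^sup>2)"
    by (simp add: fun_eq_iff power2_eq_square algebra_simps)
  finally have hb: "has_bochner_integral M (\<lambda>\<omega>. (?r * X \<omega> + a * N \<omega>)\<^sup>2) (?r\<^sup>2 + a\<^sup>2 * ou_variance m t)"
    by simp
  have sol: "AE \<omega> in M. y t \<omega> - q * X \<omega> = ?r * X \<omega> + a * N \<omega>"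
    using notA cont ycont yeq
  proof eventually_elim
    case (elim \<omega>)
    have "y t \<omega> = exp (- m * t) * X \<omega> + a * (\<beta> t \<omega> - m * integral {0..t} (\<lambda>s. exp (- m * (t - s)) * \<beta> s \<omega>))"
      using elim t by (intro linear_integral_equation_solution) auto
    moreover have "integral {0..t} (\<lambda>s. exp (- m * (t - s)) * \<beta> s \<omega>) = integral {0..t} (\<lambda>s. exp (- m * (t - s)) * W s \<omega>)"
      using elim by (intro Henstock_Kurzweil_Integration.integral_cong) (simp add: W_def)
    moreover have "W t \<omega> = \<beta> t \<omega>" using elim t by (simp add: W_def)
    ultimately show ?case unfolding N_def by (simp add: algebra_simps)
  qed
  show ?thesis
    using hb sol by (subst has_bochner_integral_cong_AE) auto
qed

section \<open>Covariances of the initial state and the noise\<close>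

text \<open>Fubini for products of functions of single coordinates. Lebesgue measure on a Euclidean space is the image
of a product measure indexed by \<open>Basis\<close>, so the coordinates are renamed along \<open>i \<mapsto> axis i 1\<close>.\<close>

lemma has_bochner_integral_prod_lborel_vec:
  fixes f :: "'n::finite \<Rightarrow> real \<Rightarrow> real"
  assumes f: "\<And>i. integrable lborel (f i)"
  shows "has_bochner_integral (lborel :: (real^'n) measure) (\<lambda>v. \<Prod>i\<in>UNIV. f i (v $ i))
    (\<Prod>i\<in>UNIV. integral\<^sup>L lborel (f i))"
proof -
  interpret product_sigma_finite "\<lambda>_::real^'n. lborel :: real measure"
    by standard
  define e where "e i = (axis i 1 :: real^'n)" for i :: 'n
  have e: "inj e" by (auto simp: e_def inj_def axis_eq_axis)
  have B: "(Basis :: (real^'n) set) = range e" by (auto simp: Basis_vec_def e_def)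
  define g where "g b = f (inv e b)" for b
  have ge: "g (e i) = f i" for i using e by (simp add: g_def)
  have eval: "(\<Sum>b\<in>Basis. x b *\<^sub>R b) $ i = x (e i)" for x :: "real^'n \<Rightarrow> real" and i
  proof -
    have "(\<Sum>b\<in>Basis. x b *\<^sub>R b) $ i = (\<Sum>j\<in>UNIV. x (e j) * (e j $ i))"
      unfolding B by (simp add: sum.reindex[OF e])
    also have "\<dots> = (\<Sum>j\<in>UNIV. if j = i then x (e i) else 0)"
      by (rule sum.cong) (auto simp: e_def axis_def)
    finally show ?thesis by simp
  qed
  have P: "(\<Prod>i\<in>UNIV. f i (x (e i))) = (\<Prod>b\<in>Basis. g b (x b))" for x
    unfolding B by (simp add: prod.reindex[OF e] ge)
  have I: "(\<Prod>i\<in>UNIV. integral\<^sup>L lborel (f i)) = (\<Prod>b\<in>Basis. integral\<^sup>L lborel (g b))"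
    unfolding B by (simp add: prod.reindex[OF e] ge)
  have g: "integrable lborel (g b)" for b unfolding g_def by (rule f)
  have [measurable]: "f i \<in> borel_measurable borel" for i
    using borel_measurable_integrable[OF f] by simp
  have m: "(\<lambda>v::real^'n. \<Prod>i\<in>UNIV. f i (v $ i)) \<in> borel_measurable borel"
    by (intro borel_measurable_prod measurable_compose[OF borel_measurable_nth]) simp
  have T: "(\<lambda>x. \<Sum>b\<in>Basis. x b *\<^sub>R b) \<in> (\<Pi>\<^sub>M b\<in>(Basis::(real^'n) set). (lborel::real measure)) \<rightarrow>\<^sub>M borel"
    by measurable
  have "has_bochner_integral (\<Pi>\<^sub>M b\<in>(Basis::(real^'n) set). (lborel::real measure)) (\<lambda>x. \<Prod>b\<in>Basis. g b (x b))
      (\<Prod>b\<in>Basis. integral\<^sup>L lborel (g b))"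
    unfolding has_bochner_integral_iff
    by (intro conjI product_integrable_prod product_integral_prod g) auto
  then show ?thesis
    unfolding I has_bochner_integral_iff
    by (subst (1 2) lborel_eq)
      (simp add: integrable_distr_eq[OF T m] integral_distr[OF T m] eval[simplified] P)
qed

lemma gaussian_density_standard:
  "gaussian_density 0 (mat 1) (v :: real^'n) = (\<Prod>i\<in>UNIV. std_normal_density (v $ i))"
proof -
  have inv: "matrix_inv (mat 1) = (mat 1 :: real^'n^'n)"
    unfolding matrix_inv_def by (rule some_equality) auto
  have root: "sqrt ((2 * pi) ^ CARD('n)) = (\<Prod>i\<in>(UNIV::'n set). sqrt (2 * pi))"
    by (simp only: prod_constant real_sqrt_power)
  have exp: "exp (- (v \<bullet> v) / 2) = (\<Prod>i\<in>UNIV. exp (- (v $ i)\<^sup>2 / 2))"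
    by (simp add: inner_vec_def power2_eq_square sum_negf[symmetric] sum_divide_distrib exp_sum)
  have std: "std_normal_density z = exp (- z\<^sup>2 / 2) / sqrt (2 * pi)" for z
    by (simp add: std_normal_density_def)
  have "gaussian_density 0 (mat 1) v = exp (- (v \<bullet> v) / 2) / sqrt ((2 * pi) ^ CARD('n))"
    unfolding gaussian_density_def inv by simp
  also have "\<dots> = (\<Prod>i\<in>UNIV. exp (- (v $ i)\<^sup>2 / 2)) / (\<Prod>i\<in>(UNIV::'n set). sqrt (2 * pi))"
    by (simp only: root exp)
  also have "\<dots> = (\<Prod>i\<in>UNIV. exp (- (v $ i)\<^sup>2 / 2) / sqrt (2 * pi))"
    by (rule prod_dividef[symmetric])
  finally show ?thesis by (simp only: std)
qed

text \<open>The density factorises, so \<open>v $ i * v $ j\<close> has to be written as a product over all coordinates. The exponent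
\<open>p k\<close> counts how often \<open>k\<close> occurs among \<open>i\<close> and \<open>j\<close>; the moments of order zero, one and two of the standard
normal distribution are \<open>1\<close>, \<open>0\<close> and \<open>1\<close>.\<close>

lemma (in prob_space) standard_gaussian_covariance:
  fixes c :: "'a \<Rightarrow> real^'n"
  assumes "distributed M lborel c (gaussian_density 0 (mat 1))"
  shows "has_bochner_integral M (\<lambda>\<omega>. c \<omega> $ i * c \<omega> $ j) (if i = j then 1 else 0)"
proof -
  define p where "p k = (of_bool (k = i) + of_bool (k = j) :: nat)" for k
  have int: "integrable lborel (\<lambda>z. std_normal_density z * z ^ p k)" for k
    by (rule integrable_std_normal_moment)
  have mono: "(\<Prod>k\<in>UNIV. (v $ k) ^ p k) = v $ i * v $ j" for v :: "real^'n"
  proof -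
    have *: "(\<Prod>k\<in>UNIV. (v $ k) ^ of_bool (k = l)) = v $ l" for l
    proof -
      have "(\<Prod>k\<in>UNIV. (v $ k) ^ of_bool (k = l)) = (\<Prod>k\<in>UNIV. if k = l then v $ l else 1)"
        by (rule prod.cong) auto
      then show ?thesis by simp
    qed
    show ?thesis by (simp add: p_def power_add prod.distrib *)
  qed
  have m0: "(\<integral>z. std_normal_density z * z ^ 0 \<partial>lborel) = 1"
    using integral_std_normal_moment_even[of 0] by simp
  have m1: "(\<integral>z. std_normal_density z * z ^ 1 \<partial>lborel) = 0"
    using integral_std_normal_moment_odd[of 0] by simp
  have m2: "(\<integral>z. std_normal_density z * z ^ 2 \<partial>lborel) = 1"
    using integral_std_normal_moment_even[of 1] by (simp add: fact_numeral)
  have val: "(\<Prod>k\<in>UNIV. \<integral>z. std_normal_density z * z ^ p k \<partial>lborel) = (if i = j then 1 else 0)"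
  proof (cases "i = j")
    case True
    then have "(\<integral>z. std_normal_density z * z ^ p k \<partial>lborel) = 1" for k
      using m0 m2 by (cases "k = i") (simp_all add: p_def numeral_2_eq_2)
    then show ?thesis using True by simp
  next
    case False
    then have "(\<integral>z. std_normal_density z * z ^ p i \<partial>lborel) = 0" using m1 by (simp add: p_def)
    then have "(\<Prod>k\<in>UNIV. \<integral>z. std_normal_density z * z ^ p k \<partial>lborel) = 0"
      by (intro prod_zero) auto
    then show ?thesis using False by simp
  qed
  have "has_bochner_integral lborel (\<lambda>v::real^'n. \<Prod>k\<in>UNIV. std_normal_density (v $ k) * (v $ k) ^ p k)
      (if i = j then 1 else 0)"
    using has_bochner_integral_prod_lborel_vec[of "\<lambda>k z. std_normal_density z * z ^ p k", OF int] unfolding val .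
  then have hb: "has_bochner_integral lborel (\<lambda>v::real^'n. gaussian_density 0 (mat 1) v * (v $ i * v $ j))
      (if i = j then 1 else 0)"
    by (simp add: prod.distrib mono gaussian_density_standard)
  have nn: "0 \<le> gaussian_density 0 (mat 1) v" for v :: "real^'n"
    unfolding gaussian_density_standard by (intro prod_nonneg) simp
  have m: "(\<lambda>v::real^'n. v $ i * v $ j) \<in> borel_measurable lborel" by simp
  show ?thesis
    using hb distributed_integral[OF assms m nn] distributed_integrable[OF assms m nn]
    unfolding has_bochner_integral_iff by simp
qed

text \<open>A covariance matrix that is a multiple of the identity looks the same in every orthonormal basis. This is
why the noise and the initial state keep their second moments in the eigenbasis of the Laplacian.\<close>

lemma has_bochner_integral_inner_mult:
  fixes X Y :: "'a \<Rightarrow> real^'n"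
  assumes "\<And>i j. has_bochner_integral M (\<lambda>\<omega>. X \<omega> $ i * Y \<omega> $ j) (if i = j then r else 0)"
  shows "has_bochner_integral M (\<lambda>\<omega>. (v \<bullet> X \<omega>) * (v \<bullet> Y \<omega>)) (r * (v \<bullet> v))"
proof -
  have "has_bochner_integral M (\<lambda>\<omega>. \<Sum>i\<in>UNIV. \<Sum>j\<in>UNIV. v $ i * v $ j * (X \<omega> $ i * Y \<omega> $ j))
      (\<Sum>i\<in>UNIV. \<Sum>j\<in>UNIV. v $ i * v $ j * (if i = j then r else 0))"
    by (intro has_bochner_integral_sum has_bochner_integral_mult_right assms)
  moreover have "(\<Sum>i\<in>UNIV. \<Sum>j\<in>UNIV. v $ i * v $ j * (if i = j then r else 0)) = r * (v \<bullet> v)"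
    by (simp add: inner_vec_def sum_distrib_left mult_ac if_distrib cong: if_cong)
  moreover have "(\<Sum>i\<in>UNIV. \<Sum>j\<in>UNIV. v $ i * v $ j * (X \<omega> $ i * Y \<omega> $ j)) = (v \<bullet> X \<omega>) * (v \<bullet> Y \<omega>)" for \<omega>
    by (simp add: inner_vec_def sum_product mult_ac)
  ultimately show ?thesis by simp
qed

lemma (in prob_space) wiener_increment_moments:
  assumes W: "standard_wiener M W" and su: "0 \<le> s" "s < u"
  shows "has_bochner_integral M (\<lambda>\<omega>. W u \<omega> - W s \<omega>) 0"
    "has_bochner_integral M (\<lambda>\<omega>. (W u \<omega> - W s \<omega>)\<^sup>2) (u - s)"
proof -
  have D: "distributed M lborel (\<lambda>\<omega>. W u \<omega> - W s \<omega>) (normal_density 0 (sqrt (u - s)))"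
    using W su by (simp add: standard_wiener_def)
  have pos: "0 < sqrt (u - s)" using su by simp
  have m1: "has_bochner_integral lborel (\<lambda>z. normal_density 0 (sqrt (u - s)) z * z) 0"
    using normal_moment_nz_1[OF pos, of 0] .
  have m2: "has_bochner_integral lborel (\<lambda>z. normal_density 0 (sqrt (u - s)) z * z\<^sup>2) (u - s)"
    using normal_moment_even[OF pos, of 0 1] su by (simp add: diff_divide_distrib)
  show "has_bochner_integral M (\<lambda>\<omega>. W u \<omega> - W s \<omega>) 0"
    using m1 distributed_integral[OF D, of "\<lambda>z. z"] distributed_integrable[OF D, of "\<lambda>z. z"]
    unfolding has_bochner_integral_iff by simp
  show "has_bochner_integral M (\<lambda>\<omega>. (W u \<omega> - W s \<omega>)\<^sup>2) (u - s)"
    using m2 distributed_integral[OF D, of "\<lambda>z. z\<^sup>2"] distributed_integrable[OF D, of "\<lambda>z. z\<^sup>2"]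
    unfolding has_bochner_integral_iff by simp
qed

lemma (in prob_space) wiener_displacement_mean:
  assumes "standard_wiener M W" "0 \<le> s"
  shows "has_bochner_integral M (\<lambda>\<omega>. W s \<omega> - W 0 \<omega>) 0"
  using wiener_increment_moments(1)[OF assms(1), of 0 s] assms(2) by (cases "s = 0") (auto simp: has_bochner_integral_zero)

text \<open>For \<open>s < u\<close>, split \<open>W u - W 0\<close> at \<open>s\<close>: the increment after \<open>s\<close> is centred and independent of \<open>W s - W 0\<close>.\<close>

lemma (in prob_space) wiener_covariance:
  assumes W: "standard_wiener M W" and "0 \<le> s" "0 \<le> u"
  shows "has_bochner_integral M (\<lambda>\<omega>. (W s \<omega> - W 0 \<omega>) * (W u \<omega> - W 0 \<omega>)) (min s u)"
  using assms(2,3)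
proof (induction s u rule: linorder_wlog)
  case (sym s u)
  then show ?case by (simp add: mult.commute min.commute)
next
  case (le s u)
  have sq: "has_bochner_integral M (\<lambda>\<omega>. (W s \<omega> - W 0 \<omega>)\<^sup>2) s"
    using wiener_increment_moments(2)[OF W, of 0 s] le by (cases "s = 0") (auto simp: has_bochner_integral_zero)
  consider "s = 0" | "s = u" | "0 < s" "s < u" using le by fastforce
  then show ?case
  proof cases
    case 1
    then show ?thesis using le by (simp add: has_bochner_integral_zero)
  next
    case 2
    then show ?thesis using sq by (simp add: power2_eq_square)
  next
    case 3
    define \<tau> where "\<tau> i = (if i = 0 then 0 else if i = 1 then s else u)" for i :: nat
    define D where "D i \<omega> = W (\<tau> (Suc i)) \<omega> - W (\<tau> i) \<omega>" for i \<omega>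
    have "\<forall>i<2. \<tau> i < \<tau> (Suc i)" using 3 by (auto simp: \<tau>_def less_2_cases_iff)
    moreover have "0 \<le> \<tau> 0" by (simp add: \<tau>_def)
    ultimately have ind: "indep_vars (\<lambda>_. borel) D {..<2}"
      using W unfolding standard_wiener_def D_def by blast
    have D: "D 0 = (\<lambda>\<omega>. W s \<omega> - W 0 \<omega>)" "D 1 = (\<lambda>\<omega>. W u \<omega> - W s \<omega>)"
      by (auto simp: D_def \<tau>_def)
    have hD: "has_bochner_integral M (D 0) 0" "has_bochner_integral M (D 1) 0"
      unfolding D using wiener_increment_moments(1)[OF W] 3 by auto
    have int: "integrable M (D i)" if "i \<in> {..<2}" for i
      using that hD by (auto simp: less_2_cases_iff has_bochner_integral_iff)
    have "has_bochner_integral M (\<lambda>\<omega>. \<Prod>i<2. D i \<omega>) 0"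
      unfolding has_bochner_integral_iff
      using indep_vars_integrable[OF _ ind int] indep_vars_lebesgue_integral[OF _ ind int] hD(1)
      by (simp add: numeral_2_eq_2 has_bochner_integral_iff)
    then have "has_bochner_integral M (\<lambda>\<omega>. (W s \<omega> - W 0 \<omega>) * (W u \<omega> - W s \<omega>)) 0"
      by (simp add: numeral_2_eq_2 D[unfolded One_nat_def])
    from has_bochner_integral_add[OF sq this] show ?thesis
      using 3 by (simp add: power2_eq_square algebra_simps)
  qed
qed

lemma (in prob_space) wiener_vec_covariance:
  fixes b :: "real \<Rightarrow> 'a \<Rightarrow> real^'n"
  assumes b: "standard_wiener_vec M b" and "0 \<le> s" "0 \<le> u"
  shows "has_bochner_integral M (\<lambda>\<omega>. (b s \<omega> - b 0 \<omega>) $ i * (b u \<omega> - b 0 \<omega>) $ j) (if i = j then min s u else 0)"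
proof -
  have W: "standard_wiener M (\<lambda>t \<omega>. b t \<omega> $ k)" for k
    using b by (simp add: standard_wiener_vec_def)
  show ?thesis
  proof (cases "i = j")
    case True
    then show ?thesis using wiener_covariance[OF W assms(2,3), of i] by simp
  next
    case False
    \<comment> \<open>Component \<open>i\<close> is read off at time \<open>s\<close>; the other components, in particular \<open>j\<close>, at time \<open>u\<close>.\<close>
    define D where "D k \<omega> = b (if k = i then s else u) \<omega> $ k - b 0 \<omega> $ k" for k \<omega>
    have "indep_vars (\<lambda>_. path_algebra) (\<lambda>k. path_map (\<lambda>t \<omega>. b t \<omega> $ k)) UNIV"
      using b by (simp add: standard_wiener_vec_def)
    then have "indep_vars (\<lambda>_. borel)
        (\<lambda>k \<omega>. (\<lambda>p. p (if k = i then s else u) - p 0) (path_map (\<lambda>t \<omega>. b t \<omega> $ k) \<omega>)) UNIV"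
      by (rule indep_vars_compose2) (use assms(2,3) in \<open>auto intro!: borel_measurable_diff measurable_component_singleton\<close>)
    also have "(\<lambda>k \<omega>. (\<lambda>p. p (if k = i then s else u) - p 0) (path_map (\<lambda>t \<omega>. b t \<omega> $ k) \<omega>)) = D"
      using assms(2,3) by (simp add: path_map_def D_def fun_eq_iff)
    finally have ind: "indep_vars (\<lambda>_. borel) D {i, j}" by (rule indep_vars_subset) simp
    have hD: "has_bochner_integral M (D k) 0" for k
      unfolding D_def using wiener_displacement_mean[OF W] assms(2,3) by auto
    have int: "integrable M (D k)" for k using hD by (auto simp: has_bochner_integral_iff)
    have "has_bochner_integral M (\<lambda>\<omega>. \<Prod>k\<in>{i, j}. D k \<omega>) 0"
      unfolding has_bochner_integral_iff
      using indep_vars_integrable[OF _ ind int] indep_vars_lebesgue_integral[OF _ ind int] hD False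
      by (simp add: has_bochner_integral_iff)
    then show ?thesis using False by (simp add: D_def)
  qed
qed

text \<open>Both factors are measurable for the sigma-algebras generated by \<open>c\<close> and by the paths of \<open>b\<close>, which are
independent, and the second factor is centred.\<close>

lemma (in prob_space) initial_noise_uncorrelated:
  fixes b :: "real \<Rightarrow> 'a \<Rightarrow> real^'n" and c :: "'a \<Rightarrow> real^'n"
  assumes b: "standard_wiener_vec M b" and ind: "indep_of_process M c b"
    and c: "integrable M (\<lambda>\<omega>. c \<omega> $ i)" and s: "0 \<le> s"
  shows "has_bochner_integral M (\<lambda>\<omega>. c \<omega> $ i * (b s \<omega> - b 0 \<omega>) $ j) 0"
proof -
  let ?C = "vimage_algebra (space M) c borel"
  let ?B = "vimage_algebra (space M) (path_map b) path_algebra"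
  have "path_map b \<in> space M \<rightarrow> space path_algebra"
    by (auto simp: path_map_def space_PiM)
  from measurable_vimage_algebra1[OF this]
  have pm: "path_map b \<in> ?B \<rightarrow>\<^sub>M path_algebra" .
  have "(\<lambda>\<omega>. path_map b \<omega> r) \<in> borel_measurable ?B" if "0 \<le> r" for r
    by (rule measurable_compose[OF pm measurable_component_singleton]) (use that in simp)
  then have "(\<lambda>\<omega>. path_map b \<omega> s - path_map b \<omega> 0) \<in> borel_measurable ?B"
    using s by (intro borel_measurable_diff) auto
  from measurable_compose[OF this borel_measurable_nth]
  have "(\<lambda>\<omega>. (path_map b \<omega> s - path_map b \<omega> 0) $ j) \<in> borel_measurable ?B" .
  moreover have "path_map b \<omega> s - path_map b \<omega> 0 = b s \<omega> - b 0 \<omega>" for \<omega>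
    using s by (simp add: path_map_def)
  ultimately have wB: "(\<lambda>\<omega>. (b s \<omega> - b 0 \<omega>) $ j) \<in> borel_measurable ?B" by simp
  have "c \<in> borel_measurable ?C" by (rule measurable_vimage_algebra1) simp
  then have cC: "(\<lambda>\<omega>. c \<omega> $ i) \<in> borel_measurable ?C"
    by (rule measurable_compose[OF _ borel_measurable_nth])
  have w: "has_bochner_integral M (\<lambda>\<omega>. (b s \<omega> - b 0 \<omega>) $ j) 0"
    using wiener_displacement_mean[of "\<lambda>t \<omega>. b t \<omega> $ j"] b s by (simp add: standard_wiener_vec_def)
  have gen: "sigma_sets (space M) {X -` A \<inter> space M |A. A \<in> sets borel} \<subseteq> sets (vimage_algebra (space M) f N)"
    if "X \<in> borel_measurable (vimage_algebra (space M) f N)" for X :: "'a \<Rightarrow> real" and f and N :: "'c measure"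
  proof -
    have "{X -` A \<inter> space M |A. A \<in> sets borel} \<subseteq> sets (vimage_algebra (space M) f N)"
      using measurable_sets[OF that] by auto
    from sets.sigma_sets_subset[OF this] show ?thesis by simp
  qed
  have indCB: "indep_set (sets ?C) (sets ?B)" using ind by (simp add: indep_of_process_def)
  have iv: "indep_var borel (\<lambda>\<omega>. c \<omega> $ i) borel (\<lambda>\<omega>. (b s \<omega> - b 0 \<omega>) $ j)"
    unfolding indep_var_eq
  proof (intro conjI)
    show rv: "random_variable borel (\<lambda>\<omega>. c \<omega> $ i)" "random_variable borel (\<lambda>\<omega>. (b s \<omega> - b 0 \<omega>) $ j)"
      using c w by (auto simp: has_bochner_integral_iff)
    show "indep_set (sigma_sets (space M) {(\<lambda>\<omega>. c \<omega> $ i) -` A \<inter> space M |A. A \<in> sets borel})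
        (sigma_sets (space M) {(\<lambda>\<omega>. (b s \<omega> - b 0 \<omega>) $ j) -` A \<inter> space M |A. A \<in> sets borel})"
    proof (rule indep_setI)
      show "sigma_sets (space M) {(\<lambda>\<omega>. c \<omega> $ i) -` A \<inter> space M |A. A \<in> sets borel} \<subseteq> events"
        using measurable_sets[OF rv(1)] by (intro sets.sigma_sets_subset) auto
      show "sigma_sets (space M) {(\<lambda>\<omega>. (b s \<omega> - b 0 \<omega>) $ j) -` A \<inter> space M |A. A \<in> sets borel} \<subseteq> events"
        using measurable_sets[OF rv(2)] by (intro sets.sigma_sets_subset) auto
    qed (use gen[OF cC] gen[OF wB] indep_setD[OF indCB] in blast)
  qed
  have "integrable M (\<lambda>\<omega>. (b s \<omega> - b 0 \<omega>) $ j)" using w by (simp add: has_bochner_integral_iff)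
  from indep_var_integrable[OF iv c this] indep_var_lebesgue_integral[OF iv c this] w
  show ?thesis by (simp add: has_bochner_integral_iff)
qed

section \<open>The mean squared error\<close>

theorem corollary1:
  fixes E :: "('n::finite \<times> 'n) set" and \<mu> :: "'n \<Rightarrow> 'n \<Rightarrow> real"
    and L :: "real^'n^'n" and lam :: "nat \<Rightarrow> real" and \<alpha> :: real
    and M :: "'a measure" and b x :: "real \<Rightarrow> 'a \<Rightarrow> real^'n" and c :: "'a \<Rightarrow> real^'n"
    and \<gamma> :: "'a \<Rightarrow> real" and MSE :: "real \<Rightarrow> real" and Q :: "real \<Rightarrow> real^'n^'n"
  assumes "connected_weighted_graph E \<mu>"
    and "L = laplacian E \<mu>"
    and "ordered_eigenvalues L lam"
    and "\<alpha> > 0"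
    and "prob_space M"
    and "standard_wiener_vec M b"
    and "distributed M lborel c (gaussian_density 0 (mat 1))"
    and "indep_of_process M c b"
    and "linear_sde_solution M (- L) \<alpha> b c x"
    and "\<And>\<omega>. \<gamma> \<omega> = (\<Sum>i\<in>UNIV. c \<omega> $ i) / real CARD('n)"
    and "\<And>t. MSE t = prob_space.expectation M (\<lambda>\<omega>. (norm (x t \<omega> - \<gamma> \<omega> *\<^sub>R vec 1))\<^sup>2)"
    and "\<And>t. Q t = matrix_exp (- (t *\<^sub>R L)) ** (mat 1 - (1 / real CARD('n)) *\<^sub>R (\<chi> i j. 1))"
  shows "\<forall>t>0. MSE t = \<alpha>\<^sup>2 * t
           + \<alpha>\<^sup>2 / 2 * (\<Sum>i=2..CARD('n). (1 - exp (- 2 * lam i * t)) / lam i)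
           + trace (Q t ** transpose (Q t))"
proof (intro allI impI)
  fix t :: real assume t: "0 < t"
  interpret prob_space M by fact
  let ?J = "(1 / real CARD('n)) *\<^sub>R (\<chi> i j. 1) :: real^'n^'n"
  \<comment> \<open>The index \<open>k0\<close> is the average mode, and \<open>v\<close> is the eigenbasis.\<close>
  obtain U :: "real^'n^'n" and d k0 where U: "orthogonal_matrix U"
    and L: "L = U ** diagonal_matrix d ** transpose U"
    and d0: "d k0 = 0" and dpos: "\<And>k. k \<noteq> k0 \<Longrightarrow> 0 < d k"
    and J: "?J = U ** diagonal_matrix (\<lambda>k. of_bool (k = k0)) ** transpose U"
    by (rule laplacian_diagonalisable[OF assms(1), folded assms(2)]) (rule that; (assumption | blast))
  define q where "q k = (of_bool (k = k0) :: real)" for k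
  define v where "v k = column k U" for k
  have vv: "v k \<bullet> v k = 1" for k
    using U by (simp add: v_def orthogonal_matrix_orthonormal_columns norm_eq_1)
  have \<gamma>: "\<gamma> \<omega> *\<^sub>R vec 1 = ?J *v c \<omega>" for \<omega>
    by (simp add: assms(10) vec_eq_iff matrix_vector_mult_def sum_divide_distrib)
  have v\<gamma>: "v k \<bullet> (\<gamma> \<omega> *\<^sub>R vec 1) = q k * (v k \<bullet> c \<omega>)" for k \<omega>
    unfolding \<gamma> J v_def q_def by (rule column_inner_diagonalised[OF U])

  have sol: "\<And>s. 0 \<le> s \<Longrightarrow> x s \<in> borel_measurable M" "AE \<omega> in M. continuous_on {0..} (\<lambda>s. x s \<omega>)"
    "AE \<omega> in M. \<forall>s\<ge>0. x s \<omega> = c \<omega> + integral {0..s} (\<lambda>u. (- L) *v x u \<omega>) + \<alpha> *\<^sub>R (b s \<omega> - b 0 \<omega>)"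
    using assms(9) by (auto simp: linear_sde_solution_def)
  have W: "standard_wiener M (\<lambda>s \<omega>. b s \<omega> $ i)" for i
    using assms(6) by (simp add: standard_wiener_vec_def)
  have cov_c: "has_bochner_integral M (\<lambda>\<omega>. (v k \<bullet> c \<omega>) * (v k \<bullet> c \<omega>)) 1" for k
    using has_bochner_integral_inner_mult[OF standard_gaussian_covariance[OF assms(7)], of "v k"] vv by simp
  have cov_b: "has_bochner_integral M (\<lambda>\<omega>. (v k \<bullet> (b s \<omega> - b 0 \<omega>)) * (v k \<bullet> (b u \<omega> - b 0 \<omega>))) (min s u)"
    if "0 \<le> s" "0 \<le> u" for k s u
    using has_bochner_integral_inner_mult[OF wiener_vec_covariance[OF assms(6) that], of "v k"] vv by simp
  have c2: "integrable M (\<lambda>\<omega>. (c \<omega> $ i)\<^sup>2)" for i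
    using standard_gaussian_covariance[OF assms(7), of i i]
    by (simp add: has_bochner_integral_iff power2_eq_square)
  have cm[measurable]: "c \<in> borel_measurable M"
    using assms(7) by (simp add: distributed_def)
  have c1: "integrable M (\<lambda>\<omega>. c \<omega> $ i)" for i
    by (rule square_integrable_imp_integrable[OF _ c2])
      (rule measurable_compose[OF cm borel_measurable_nth])
  have cov_cb: "has_bochner_integral M (\<lambda>\<omega>. (v k \<bullet> c \<omega>) * (v k \<bullet> (b s \<omega> - b 0 \<omega>))) 0"
    if "0 \<le> s" for k s
    using has_bochner_integral_inner_mult[of M c "\<lambda>\<omega>. b s \<omega> - b 0 \<omega>" 0 "v k"]
      initial_noise_uncorrelated[OF assms(6,8) c1 that] by simp

  \<comment> \<open>Each mode of the error is a scalar equation with rate \<open>d k\<close>.\<close>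
  have component: "has_bochner_integral M (\<lambda>\<omega>. (v k \<bullet> x t \<omega> - q k * (v k \<bullet> c \<omega>))\<^sup>2)
      ((exp (- d k * t) - q k)\<^sup>2 + \<alpha>\<^sup>2 * ou_variance (d k) t)" for k
  proof (rule linear_sde_mean_square[where y = "\<lambda>s \<omega>. v k \<bullet> x s \<omega>" and \<beta> = "\<lambda>s \<omega>. v k \<bullet> (b s \<omega> - b 0 \<omega>)"])
    have bm: "(\<lambda>\<omega>. b s \<omega> $ i) \<in> borel_measurable M" if "0 \<le> s" for s i
      using W that by (simp add: standard_wiener_def)
    then show "(\<lambda>\<omega>. v k \<bullet> (b s \<omega> - b 0 \<omega>)) \<in> borel_measurable M" if "0 \<le> s" for s
      using that by (simp add: inner_vec_def)
    have "AE \<omega> in M. \<forall>i\<in>UNIV. continuous_on {0..} (\<lambda>s. b s \<omega> $ i)"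
      using W by (intro AE_finite_allI) (simp_all add: standard_wiener_def)
    then show "AE \<omega> in M. continuous_on {0..} (\<lambda>s. v k \<bullet> (b s \<omega> - b 0 \<omega>))"
      by eventually_elim (simp add: inner_vec_def continuous_intros)
    show "integrable M (\<lambda>\<omega>. (v k \<bullet> (b s \<omega> - b 0 \<omega>))\<^sup>2)" if "0 \<le> s" for s
      using cov_b[OF that that] by (simp add: has_bochner_integral_iff power2_eq_square)
    show "expectation (\<lambda>\<omega>. (v k \<bullet> (b s \<omega> - b 0 \<omega>)) * (v k \<bullet> (b u \<omega> - b 0 \<omega>))) = min s u"
      if "0 \<le> s" "0 \<le> u" for s u
      using cov_b[OF that] by (simp add: has_bochner_integral_iff)
    show "(\<lambda>\<omega>. v k \<bullet> c \<omega>) \<in> borel_measurable M" by measurable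
    show "integrable M (\<lambda>\<omega>. (v k \<bullet> c \<omega>)\<^sup>2)" "expectation (\<lambda>\<omega>. (v k \<bullet> c \<omega>)\<^sup>2) = 1"
      using cov_c by (simp_all add: has_bochner_integral_iff power2_eq_square)
    show "expectation (\<lambda>\<omega>. (v k \<bullet> c \<omega>) * (v k \<bullet> (b s \<omega> - b 0 \<omega>))) = 0" if "0 \<le> s" for s
      using cov_cb[OF that] by (simp add: has_bochner_integral_iff)
    show "(\<lambda>\<omega>. v k \<bullet> x t \<omega>) \<in> borel_measurable M"
      using sol(1)[of t] t by simp
    show "AE \<omega> in M. continuous_on {0..} (\<lambda>s. v k \<bullet> x s \<omega>)"
      using sol(2) by eventually_elim (intro continuous_intros)
    show "AE \<omega> in M. \<forall>s\<ge>0. v k \<bullet> x s \<omega> = v k \<bullet> c \<omega> - d k * integral {0..s} (\<lambda>u. v k \<bullet> x u \<omega>)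
        + \<alpha> * (v k \<bullet> (b s \<omega> - b 0 \<omega>))"
      using sol(2,3)
    proof eventually_elim
      case (elim \<omega>)
      show ?case
      proof (intro allI impI)
        fix s :: real assume s: "0 \<le> s"
        have "continuous_on {0..s} (\<lambda>u. x u \<omega>)" by (rule continuous_on_subset[OF elim(1)]) auto
        then have "(\<lambda>u. (- L) *v x u \<omega>) integrable_on {0..s}"
          by (intro integrable_continuous_interval linear_continuous_on_compose[of _ _ "(*v) (- L)"]) auto
        then have "v k \<bullet> integral {0..s} (\<lambda>u. (- L) *v x u \<omega>) = integral {0..s} (\<lambda>u. v k \<bullet> ((- L) *v x u \<omega>))"
          using integral_linear[OF _ bounded_linear_inner_right, of "\<lambda>u. (- L) *v x u \<omega>" "{0..s}" "v k"]
          unfolding comp_def by simp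
        also have "\<dots> = integral {0..s} (\<lambda>u. - d k * (v k \<bullet> x u \<omega>))"
        proof -
          have "v k \<bullet> (L *v z) = d k * (v k \<bullet> z)" for z
            unfolding L v_def by (rule column_inner_diagonalised[OF U])
          moreover have "(- L) *v z = - (L *v z)" for z
            by (simp add: vec_eq_iff matrix_vector_mult_def sum_negf)
          ultimately show ?thesis by simp
        qed
        also have "\<dots> = - d k * integral {0..s} (\<lambda>u. v k \<bullet> x u \<omega>)" by (rule integral_mult_right)
        finally show "v k \<bullet> x s \<omega> = v k \<bullet> c \<omega> - d k * integral {0..s} (\<lambda>u. v k \<bullet> x u \<omega>)
            + \<alpha> * (v k \<bullet> (b s \<omega> - b 0 \<omega>))"
          using elim(2) s by (simp add: inner_add_right)
      qed
    qed
  qed (rule t)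

  have "has_bochner_integral M (\<lambda>\<omega>. \<Sum>k\<in>UNIV. (v k \<bullet> x t \<omega> - q k * (v k \<bullet> c \<omega>))\<^sup>2)
      (\<Sum>k\<in>UNIV. (exp (- d k * t) - q k)\<^sup>2 + \<alpha>\<^sup>2 * ou_variance (d k) t)"
    by (intro has_bochner_integral_sum component)
  moreover have "(\<Sum>k\<in>UNIV. (v k \<bullet> x t \<omega> - q k * (v k \<bullet> c \<omega>))\<^sup>2) = (norm (x t \<omega> - \<gamma> \<omega> *\<^sub>R vec 1))\<^sup>2" for \<omega>
    unfolding norm_orthonormal_columns[OF U] v_def[symmetric] inner_diff_right v\<gamma> ..
  ultimately have "MSE t = (\<Sum>k\<in>UNIV. (exp (- d k * t) - q k)\<^sup>2 + \<alpha>\<^sup>2 * ou_variance (d k) t)"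
    by (simp add: assms(11) has_bochner_integral_iff)
  also have "\<dots> = \<alpha>\<^sup>2 * (\<Sum>k\<in>UNIV. ou_variance (d k) t) + (\<Sum>k\<in>UNIV. (exp (- d k * t) - q k)\<^sup>2)"
    by (simp add: sum.distrib sum_distrib_left)
  also have "(\<Sum>k\<in>UNIV. ou_variance (d k) t) = t + (\<Sum>i=2..CARD('n). (1 - exp (- 2 * lam i * t)) / lam i) / 2"
  proof -
    \<comment> \<open>The average mode has rate zero, so its noise is a Wiener process.\<close>
    have "(\<Sum>k\<in>UNIV. ou_variance (d k) t) = t + (\<Sum>k\<in>UNIV - {k0}. ou_variance (d k) t)"
      by (simp add: sum.remove[of UNIV k0] d0 ou_variance_def)
    also have "(\<Sum>k\<in>UNIV - {k0}. ou_variance (d k) t) = (\<Sum>k\<in>UNIV - {k0}. (1 - exp (- 2 * d k * t)) / d k / 2)"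
      by (intro sum.cong refl) (use dpos in \<open>force simp: ou_variance_def\<close>)
    also have "\<dots> = (\<Sum>k\<in>UNIV - {k0}. (1 - exp (- 2 * d k * t)) / d k) / 2"
      by (simp only: sum_divide_distrib)
    also have "(\<Sum>k\<in>UNIV - {k0}. (1 - exp (- 2 * d k * t)) / d k) =
        (\<Sum>i=2..CARD('n). (1 - exp (- 2 * lam i * t)) / lam i)"
    proof (rule sum_nonminimal_eigenvalues[symmetric, OF U, where f = "\<lambda>z. (1 - exp (- 2 * z * t)) / z"])
      show "ordered_eigenvalues (U ** diagonal_matrix d ** transpose U) lam" using assms(3) L by simp
      show "d k0 \<le> d k" for k using d0 dpos[of k] by (cases "k = k0") auto
    qed
    finally show ?thesis .
  qed
  also have "(\<Sum>k\<in>UNIV. (exp (- d k * t) - q k)\<^sup>2) = trace (Q t ** transpose (Q t))"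
  proof -
    have "- (t *\<^sub>R L) = U ** diagonal_matrix (\<lambda>k. - d k * t) ** transpose U"
      unfolding L by (simp add: vec_eq_iff orthogonal_conjugate_component sum_distrib_left sum_negf mult_ac)
    then have E: "matrix_exp (- (t *\<^sub>R L)) = U ** diagonal_matrix (\<lambda>k. exp (- d k * t)) ** transpose U"
      by (simp only: matrix_exp_diagonalised[OF U])
    have "mat 1 = U ** diagonal_matrix (\<lambda>k. 1) ** transpose U"
      using U by (simp add: diagonal_matrix_1 orthogonal_matrix_def)
    then have "mat 1 - ?J = U ** diagonal_matrix (\<lambda>k. 1 - q k) ** transpose U"
      by (simp only: J q_def orthogonal_conjugate_diff)
    then have "Q t = U ** diagonal_matrix (\<lambda>k. exp (- d k * t) * (1 - q k)) ** transpose U"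
      by (simp only: assms(12) E orthogonal_conjugate_mult[OF U])
    then have "trace (Q t ** transpose (Q t)) = (\<Sum>k\<in>UNIV. (exp (- d k * t) * (1 - q k))\<^sup>2)"
      by (rule trace_diagonalised_square[OF U])
    \<comment> \<open>At \<open>k0\<close> both sides vanish, since \<open>exp 0 = 1\<close>.\<close>
    moreover have "exp (- d k * t) * (1 - q k) = exp (- d k * t) - q k" for k
      by (cases "k = k0") (simp_all add: q_def d0)
    ultimately show ?thesis by simp
  qed
  finally show "MSE t = \<alpha>\<^sup>2 * t
           + \<alpha>\<^sup>2 / 2 * (\<Sum>i=2..CARD('n). (1 - exp (- 2 * lam i * t)) / lam i)
           + trace (Q t ** transpose (Q t))"
    by (simp add: algebra_simps)
qed

end
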